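(* Let $\mu$ be any critical offspring distribution. Then, as $n\to\infty$ along integers $n$ with $\mathbf P(|\mathrm{T}|=n)>0$, \[ \mathsf{Height}(\mathrm{T}_n)=\omega_{\mathbf P}(\ln n)\qquad\text{and}\qquad \mathsf{Width}(\mathrm{T}_n)=o_{\mathbf P}(n). \] That is, $\mathsf{Height}(\mathrm{T}_n)/\ln n\to\infty$ in probability and $\mathsf{Width}(\mathrm{T}_n)/n\to 0$ in probability.
   Context: An offspring distribution is a probability measure $\mu=(\mu_k)_{k\ge 0}$ on $\mathbb Z_+=\{0,1,2,\dots\}$; it is critical if $\sum_{k\ge0}k\mu_k=1$. A $\mu$-Bienaymé tree $\mathrm{T}=\mathrm{T}(\mu)$ is the family tree of a Galton–Watson branching process with offspring distribution $\mu$ started from one individual (a random rooted plane tree with $\mathbf P(\mathrm{T}=\mathrm t)=\prod_{u\in\mathrm t}\mu_{k_u(\mathrm t)}$ for each finite plane tree $\mathrm t$, where $k_u(\mathrm t)$ is the number of children of $u$). For $n$ with $\mathbf P(|\mathrm T|=n)>0$, $\mathrm T_n$ denotes $\mathrm T$ conditioned to have exactly $n$ vertices. The height $\mathsf{Height}(\mathrm t)$ of a rooted tree is the largest distance of a vertex from the root; the width $\mathsf{Width}(\mathrm t)$ is the largest number of vertices in a single generation (at a single distance from the root). *)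

theory Defs
  imports Complex_Main
begin

datatype ptree = Node "ptree list"

fun children :: "ptree \<Rightarrow> ptree list" where
  "children (Node ts) = ts"

fun tsize :: "ptree \<Rightarrow> nat" where
  "tsize (Node ts) = Suc (sum_list (map tsize ts))"

fun height :: "ptree \<Rightarrow> nat" where
  "height (Node ts) = Max (insert 0 ((\<lambda>s. Suc (height s)) ` set ts))"

fun gen_size :: "ptree \<Rightarrow> nat \<Rightarrow> nat" where
  "gen_size (Node ts) 0 = 1"
| "gen_size (Node ts) (Suc k) = sum_list (map (\<lambda>s. gen_size s k) ts)"

definition width :: "ptree \<Rightarrow> nat" where
  "width t = Max (gen_size t ` {0..height t})"

text \<open>Bienaym\'e weight: P(T = t) = prod over vertices u of mu(k_u(t)).\<close>
fun bw :: "(nat \<Rightarrow> real) \<Rightarrow> ptree \<Rightarrow> real" where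
  "bw \<mu> (Node ts) = \<mu> (length ts) * prod_list (map (bw \<mu>) ts)"

definition offspring_distribution :: "(nat \<Rightarrow> real) \<Rightarrow> bool" where
  "offspring_distribution \<mu> \<longleftrightarrow> (\<forall>k. 0 \<le> \<mu> k) \<and> \<mu> sums 1"

definition critical :: "(nat \<Rightarrow> real) \<Rightarrow> bool" where
  "critical \<mu> \<longleftrightarrow> (\<lambda>k. real k * \<mu> k) sums 1"

text \<open>P(|T| = n): sum of P(T = t) over the (finitely many) plane trees with n vertices.\<close>
definition size_prob :: "(nat \<Rightarrow> real) \<Rightarrow> nat \<Rightarrow> real" where
  "size_prob \<mu> n = (\<Sum>t\<in>{t. tsize t = n}. bw \<mu> t)"

definition cond_prob :: "(nat \<Rightarrow> real) \<Rightarrow> nat \<Rightarrow> (ptree \<Rightarrow> bool) \<Rightarrow> real" where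
  "cond_prob \<mu> n Q = (\<Sum>t\<in>{t. tsize t = n \<and> Q t}. bw \<mu> t) / size_prob \<mu> n"

end

theory Submission
  imports Defs "HOL-Computational_Algebra.Formal_Power_Series" "HOL-Real_Asymp.Real_Asymp"
begin

text \<open>
  List the child counts of a tree of size \<open>n\<close> in breadth-first order: each generation becomes a
  contiguous window of length \<open>Z\<^sub>h\<close> with sum \<open>Z\<^sub>h\<^sub>+\<^sub>1\<close>. If no window of length about
  \<open>C ln n\<close> has average below \<open>1 - \<delta>/2\<close>, then generations larger than a multiple of \<open>ln n\<close>
  shrink by a factor of at least \<open>1 - \<delta>\<close>. A generation with more than \<open>\<epsilon> n\<close> vertices would then
  be followed by so many large ones that the tree has more than \<open>n\<close> vertices, and a tree of height
  at most \<open>M ln n\<close> would have a generation too large to die out in the remaining time.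

  By the Otter--Dwass formula the size-\<open>n\<close> trees have, up to the factor \<open>1/n\<close>, the weight of all
  sequences of length \<open>n\<close> and sum \<open>n - 1\<close>, so it suffices that windows of small average are
  polynomially unlikely for such sequences. Given the sum, the sequence is exchangeable, and the
  exponential moment over a window is bounded by a power of the empirical average of
  \<open>exp (\<lambda> (1 - \<delta> - x))\<close> over the whole sequence. That average is below a constant less than 1
  up to an exponentially small probability, while the event of having sum \<open>n - 1\<close> has
  probability at least \<open>exp (- o(n))\<close>, by supermultiplicativity.
\<close>

subsection \<open>Convolution powers\<close>

text \<open>For an offspring distribution this is the probability that \<open>n\<close> independent
  offspring counts add up to \<open>s\<close>. The sum runs over explicit lists because later events
  concern individual positions.\<close>

definition conv_pow :: "(nat \<Rightarrow> real) \<Rightarrow> nat \<Rightarrow> nat \<Rightarrow> real" where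
  "conv_pow f n s = (\<Sum>xs\<in>natpermute s n. prod_list (map f xs))"

lemma natpermute_iff: "xs \<in> natpermute s n \<longleftrightarrow> length xs = n \<and> sum_list xs = s"
  by (auto simp: natpermute_def)

text \<open>Passing to powers of the generating function turns convolution identities into power
  series arithmetic.\<close>

lemma conv_pow_eq_fps: "conv_pow f n s = fps_nth (Abs_fps f ^ n) s"
proof (cases n)
  case 0
  have "natpermute s 0 = (if s = 0 then {[]} else {})"
    by (auto simp: natpermute_iff)
  then show ?thesis using 0 by (simp add: conv_pow_def)
next
  case (Suc m)
  have "prod_list (map f xs) = (\<Prod>j = 0..m. f (xs ! j))" if "xs \<in> natpermute s n" for xs
    using that Suc
    by (simp add: natpermute_iff prod.list_conv_set_nth atLeast0LessThan atLeast0AtMost lessThan_Suc_atMost)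
  then show ?thesis
    unfolding conv_pow_def Suc fps_power_nth_Suc by (simp add: Suc)
qed

lemma conv_pow_nonneg: "(\<And>k. 0 \<le> f k) \<Longrightarrow> 0 \<le> conv_pow f n s"
  unfolding conv_pow_def by (intro sum_nonneg prod_list_nonneg) auto

lemma conv_pow_add: "conv_pow f (m + n) s = (\<Sum>i\<le>s. conv_pow f m i * conv_pow f n (s - i))"
  by (simp add: conv_pow_eq_fps power_add fps_mult_nth atLeast0AtMost)

lemma conv_pow_1: "conv_pow f (Suc 0) = f"
  by (simp add: conv_pow_eq_fps fun_eq_iff)

lemma conv_pow_Suc: "conv_pow f (Suc n) s = (\<Sum>i\<le>s. f i * conv_pow f n (s - i))"
  using conv_pow_add[of f 1 n s] by (simp add: conv_pow_1)

lemma conv_pow_supermult: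
  assumes "\<And>k. 0 \<le> f k"
  shows "conv_pow f m s * conv_pow f n t \<le> conv_pow f (m + n) (s + t)"
proof -
  have "conv_pow f m s * conv_pow f n (s + t - s)
      \<le> (\<Sum>i\<le>s+t. conv_pow f m i * conv_pow f n (s + t - i))"
    by (rule member_le_sum) (auto intro!: mult_nonneg_nonneg conv_pow_nonneg assms)
  then show ?thesis by (simp add: conv_pow_add)
qed

lemma conv_pow_replicate_le:
  assumes "\<And>k. 0 \<le> f k"
  shows "f a ^ d \<le> conv_pow f d (a * d)"
proof (induction d)
  case 0
  then show ?case by (simp add: conv_pow_eq_fps)
next
  case (Suc d)
  have "f a ^ Suc d \<le> f a * conv_pow f d (a * d)"
    using Suc assms by (simp add: mult_left_mono)
  also have "\<dots> \<le> conv_pow f (Suc d) (a * Suc d)"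
    using conv_pow_supermult[of f 1 a d "a * d"] assms by (simp add: conv_pow_1)
  finally show ?case .
qed

text \<open>Compare coefficients in X (G^(n+1))' = (n+1) X G' G^n. Probabilistically this is
  exchangeability: given the sum \<open>s\<close> of \<open>Suc n\<close> entries, the first has
  mean s/(n+1).\<close>

lemma conv_pow_derivative:
  "real (Suc n) * (\<Sum>i\<le>s. (real i * f i) * conv_pow f n (s - i)) = real s * conv_pow f (Suc n) s"
proof -
  let ?G = "Abs_fps f"
  have D: "fps_X * fps_deriv (?G ^ Suc n) = of_nat (Suc n) * ((fps_X * fps_deriv ?G) * ?G ^ n)"
    by (simp add: fps_deriv_power' algebra_simps del: power_Suc of_nat_Suc)
  have X: "fps_nth (fps_X * fps_deriv g) k = real k * fps_nth g k" for g :: "real fps" and k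
    by (cases k) auto
  have "fps_nth (fps_X * fps_deriv (?G ^ Suc n)) s = real s * conv_pow f (Suc n) s"
    unfolding X conv_pow_eq_fps ..
  moreover have "fps_nth (of_nat (Suc n) * ((fps_X * fps_deriv ?G) * ?G ^ n)) s
      = real (Suc n) * (\<Sum>i\<le>s. (real i * f i) * conv_pow f n (s - i))"
  proof -
    have "fps_nth (of_nat (Suc n) * F) s = real (Suc n) * fps_nth F s" for F :: "real fps"
      by (simp only: fps_of_nat[symmetric] fps_mult_left_const_nth)
    then show ?thesis
      by (simp only: fps_mult_nth[of "fps_X * fps_deriv ?G"] X fps_nth_Abs_fps conv_pow_eq_fps atLeast0AtMost)
  qed
  ultimately show ?thesis by (simp only: D)
qed

lemma conv_pow_sums:
  assumes "\<And>k. 0 \<le> f k" "f sums a"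
  shows "conv_pow f n sums (a ^ n)"
proof (induction n)
  case 0
  have "conv_pow f 0 = (\<lambda>s. if s = 0 then 1 else 0)"
    by (auto simp: conv_pow_eq_fps fun_eq_iff)
  then show ?case using sums_single[of 0 "\<lambda>_. 1::real"] by simp
next
  case (Suc n)
  have "(\<lambda>k. \<Sum>i\<le>k. f i * conv_pow f n (k - i)) sums ((\<Sum>k. f k) * (\<Sum>k. conv_pow f n k))"
    using assms Suc by (intro Cauchy_product_sums)
      (auto simp: sums_iff conv_pow_nonneg)
  moreover have "conv_pow f (Suc n) = (\<lambda>k. \<Sum>i\<le>k. f i * conv_pow f n (k - i))"
    by (simp add: conv_pow_Suc fun_eq_iff)
  ultimately show ?case using Suc assms by (simp add: sums_iff)
qed

lemma conv_pow_le_power: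
  assumes "\<And>k. 0 \<le> f k" "f sums a"
  shows "conv_pow f n s \<le> a ^ n"
  using conv_pow_sums[OF assms, of n] sum_le_suminf[of "conv_pow f n" "{s}"]
  by (simp add: sums_iff conv_pow_nonneg assms)

text \<open>The derivative identity writes each term as \<open>n\<close> times a coefficient of the
  Cauchy product of \<open>real i * f i\<close> with a convolution power of total mass 1.\<close>

lemma conv_pow_mean_sums:
  assumes "\<And>k. 0 \<le> f k" "f sums 1" "(\<lambda>k. real k * f k) sums b"
  shows "(\<lambda>s. real s * conv_pow f n s) sums (real n * b)"
proof (cases n)
  case 0
  have "(\<lambda>s. real s * conv_pow f 0 s) = (\<lambda>s. 0)"
    by (auto simp: conv_pow_eq_fps fun_eq_iff)
  then show ?thesis using 0 by simp
next
  case (Suc m)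
  note S = conv_pow_sums[OF assms(1,2), of m]
  have "(\<lambda>k. \<Sum>i\<le>k. (real i * f i) * conv_pow f m (k - i))
      sums ((\<Sum>k. real k * f k) * (\<Sum>k. conv_pow f m k))"
    using assms S by (intro Cauchy_product_sums) (auto simp: sums_iff conv_pow_nonneg)
  then have "(\<lambda>k. real (Suc m) * (\<Sum>i\<le>k. (real i * f i) * conv_pow f m (k - i)))
      sums (real (Suc m) * (b * 1))"
    using assms S by (intro sums_mult) (simp add: sums_iff)
  then show ?thesis unfolding conv_pow_derivative Suc by simp
qed

text \<open>The exponential factor is multiplicative along a list, hence depends on the sum
  only.\<close>

lemma conv_pow_tilt:
  "conv_pow (\<lambda>k. f k * exp (c * real k)) n s = exp (c * real s) * conv_pow f n s"
proof -
  have "prod_list (map (\<lambda>k. f k * exp (c * real k)) xs) = exp (c * real (sum_list xs)) * prod_list (map f xs)"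
    for xs by (induction xs) (auto simp: algebra_simps exp_add)
  then show ?thesis
    by (simp add: conv_pow_def sum_distrib_left natpermute_iff)
qed

lemma conv_pow_scale: "conv_pow (\<lambda>k. c * f k) n s = c ^ n * conv_pow f n s"
proof -
  have "prod_list (map (\<lambda>k. c * f k) xs) = c ^ length xs * prod_list (map f xs)" for xs
    by (induction xs) auto
  then show ?thesis
    by (simp add: conv_pow_def sum_distrib_left natpermute_iff)
qed

lemma conv_pow_mono:
  assumes "\<And>k. 0 \<le> f k" "\<And>k. f k \<le> g k"
  shows "conv_pow f n s \<le> conv_pow g n s"
proof -
  have "0 \<le> prod_list (map f xs) \<and> prod_list (map f xs) \<le> prod_list (map g xs)" for xs
    using assms by (induction xs) (auto intro!: mult_mono intro: order_trans)
  then show ?thesis unfolding conv_pow_def by (simp add: sum_mono)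
qed

subsection \<open>Forests and the Otter--Dwass formula\<close>

text \<open>Keeping the number of roots as a parameter makes the recursion on the total size
  closed.\<close>

definition forests :: "nat \<Rightarrow> nat \<Rightarrow> ptree list set" where
  "forests k n = {ts. length ts = k \<and> sum_list (map tsize ts) = n}"

definition forest_weight :: "(nat \<Rightarrow> real) \<Rightarrow> nat \<Rightarrow> nat \<Rightarrow> real" where
  "forest_weight \<mu> k n = (\<Sum>ts\<in>forests k n. prod_list (map (bw \<mu>) ts))"

lemma tsize_pos: "0 < tsize t"
  by (cases t) auto

lemma length_le_forest_size: "length ts \<le> sum_list (map tsize ts)"
proof (induction ts)
  case (Cons t ts)
  then show ?case using tsize_pos[of t] by simp
qed simp

lemma forests_empty: "n < k \<Longrightarrow> forests k n = {}"
  using length_le_forest_size by (auto simp: forests_def simp flip: not_le)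

lemma forests_0: "forests 0 n = (if n = 0 then {[]} else {})"
  by (auto simp: forests_def)

text \<open>Inverse of the exploration step that deletes the first root and puts its
  \<open>j\<close> children in its place.\<close>

definition graft :: "nat \<Rightarrow> ptree list \<Rightarrow> ptree list" where
  "graft j us = Node (take j us) # drop j us"

lemma forests_Suc: "forests (Suc k) (Suc n) = (\<Union>j\<le>n. graft j ` forests (j + k) n)"
proof (intro equalityI subsetI)
  fix ts assume "ts \<in> forests (Suc k) (Suc n)"
  then obtain cs rest where ts: "ts = Node cs # rest" "length rest = k"
      "sum_list (map tsize (cs @ rest)) = n"
    by (cases ts; cases "hd ts") (auto simp: forests_def)
  have "cs @ rest \<in> forests (length cs + k) n" using ts by (simp add: forests_def)
  moreover have "graft (length cs) (cs @ rest) = ts" using ts by (simp add: graft_def)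
  moreover have "length cs \<le> n" using length_le_forest_size[of "cs @ rest"] ts by simp
  ultimately show "ts \<in> (\<Union>j\<le>n. graft j ` forests (j + k) n)" by blast
next
  fix ts assume "ts \<in> (\<Union>j\<le>n. graft j ` forests (j + k) n)"
  then obtain j us where us: "us \<in> forests (j + k) n" "ts = graft j us" by blast
  have "sum_list (map tsize (take j us)) + sum_list (map tsize (drop j us)) = n"
    using us by (simp add: forests_def flip: sum_list_append map_append)
  then show "ts \<in> forests (Suc k) (Suc n)"
    using us by (simp add: forests_def graft_def)
qed

lemma finite_forests: "finite (forests k n)"
proof (induction n arbitrary: k)
  case 0
  then show ?case by (cases k) (auto simp: forests_0 forests_empty)
next
  case (Suc n)
  then show ?case by (cases k) (auto simp: forests_0 forests_Suc)
qed

lemma inj_on_graft: "inj_on (graft j) (forests (j + k) n)"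
  by (rule inj_onI) (metis append_take_drop_id graft_def list.inject ptree.inject)

text \<open>Sort the forests by the child count \<open>j\<close> of the first root. Since
  \<open>j\<close> can be read off the forest, the images under \<open>graft j\<close> are
  disjoint.\<close>

lemma forest_weight_Suc:
  "forest_weight \<mu> (Suc k) (Suc n) = (\<Sum>j\<le>n. \<mu> j * forest_weight \<mu> (j + k) n)"
proof -
  have disj: "graft i ` forests (i + k) n \<inter> graft j ` forests (j + k) n = {}" if "i \<noteq> j" for i j
  proof -
    have "length (children (hd t)) = i" if "t \<in> graft i ` forests (i + k) n" for t i
      using that by (auto simp: graft_def forests_def)
    then show ?thesis using that by (metis disjoint_iff)
  qed
  have w: "prod_list (map (bw \<mu>) (graft j us)) = \<mu> j * prod_list (map (bw \<mu>) us)"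
    if "us \<in> forests (j + k) n" for j us
  proof -
    have "prod_list (map (bw \<mu>) (graft j us)) = \<mu> j * prod_list (map (bw \<mu>) (take j us @ drop j us))"
      using that by (simp add: forests_def graft_def del: append_take_drop_id)
    then show ?thesis by simp
  qed
  have "forest_weight \<mu> (Suc k) (Suc n)
      = (\<Sum>j\<le>n. \<Sum>ts\<in>graft j ` forests (j + k) n. prod_list (map (bw \<mu>) ts))"
    unfolding forest_weight_def forests_Suc
    by (rule sum.UNION_disjoint) (auto simp: finite_forests dest: disj)
  also have "\<dots> = (\<Sum>j\<le>n. \<Sum>us\<in>forests (j + k) n. \<mu> j * prod_list (map (bw \<mu>) us))"
    by (rule sum.cong[OF refl]) (simp add: sum.reindex[OF inj_on_graft] w)
  finally show ?thesis by (simp add: forest_weight_def sum_distrib_left)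
qed

text \<open>Induction by deleting the first root. In the factor \<open>j + k'\<close> of the
  induction hypothesis, the part \<open>j\<close> is summed by \<open>conv_pow_derivative\<close>
  and the part \<open>k'\<close> by plain convolution. The recursion is multiplied by
  \<open>real n\<close> to apply the hypothesis, so the single vertex is treated separately.\<close>

theorem otter_dwass:
  assumes "0 < n" "k \<le> n"
  shows "real n * forest_weight \<mu> k n = real k * conv_pow \<mu> n (n - k)"
  using assms
proof (induction n arbitrary: k)
  case (Suc n)
  show ?case
  proof (cases k)
    case 0
    then show ?thesis by (simp add: forest_weight_def forests_0)
  next
    case (Suc k')
    show ?thesis
    proof (cases "n = 0")
      case True
      then have "k' = 0" using Suc Suc.prems by simp
      then show ?thesis using True Suc forest_weight_Suc[of \<mu> 0 0]
        by (simp add: forest_weight_def forests_0 conv_pow_1)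
    next
      case False
      define s where "s = n - k'"
      have kn: "k' \<le> n" using Suc Suc.prems by simp
      have "forest_weight \<mu> k (Suc n) = (\<Sum>j\<le>n. \<mu> j * forest_weight \<mu> (j + k') n)"
        unfolding Suc forest_weight_Suc ..
      \<comment> \<open>For \<open>j > s\<close> the forest would have more roots than
        vertices.\<close>
      also have "\<dots> = (\<Sum>j\<le>s. \<mu> j * forest_weight \<mu> (j + k') n)"
        by (rule sum.mono_neutral_right) (auto simp: s_def forest_weight_def forests_empty)
      finally have "real n * forest_weight \<mu> k (Suc n)
          = (\<Sum>j\<le>s. \<mu> j * (real n * forest_weight \<mu> (j + k') n))"
        by (simp add: sum_distrib_left algebra_simps)
      also have "\<dots> = (\<Sum>j\<le>s. \<mu> j * (real (j + k') * conv_pow \<mu> n (s - j)))"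
      proof (intro sum.cong refl)
        fix j assume "j \<in> {..s}"
        then have "j + k' \<le> n" "n - (j + k') = s - j" using kn by (auto simp: s_def)
        then show "\<mu> j * (real n * forest_weight \<mu> (j + k') n) = \<mu> j * (real (j + k') * conv_pow \<mu> n (s - j))"
          using Suc.IH[of "j + k'"] False by simp
      qed
      also have "\<dots> = (\<Sum>j\<le>s. (real j * \<mu> j) * conv_pow \<mu> n (s - j))
          + real k' * (\<Sum>j\<le>s. \<mu> j * conv_pow \<mu> n (s - j))"
        by (simp add: sum.distrib[symmetric] sum_distrib_left algebra_simps)
      finally have "real (Suc n) * (real n * forest_weight \<mu> k (Suc n))
          = real s * conv_pow \<mu> (Suc n) s + real (Suc n) * (real k' * conv_pow \<mu> (Suc n) s)"
        using conv_pow_derivative[of n \<mu> s] conv_pow_Suc[of \<mu> n s]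
        by (simp only: distrib_left)
      \<comment> \<open>Here \<open>s + Suc n * k' = n * Suc k'\<close>, so the factor
        \<open>n\<close> can be cancelled.\<close>
      also have "\<dots> = real n * (real k * conv_pow \<mu> (Suc n) s)"
        using kn by (simp add: s_def Suc algebra_simps)
      finally have "real n * (real (Suc n) * forest_weight \<mu> k (Suc n)) = real n * (real k * conv_pow \<mu> (Suc n) s)"
        by (simp only: mult.left_commute)
      then have "real (Suc n) * forest_weight \<mu> k (Suc n) = real k * conv_pow \<mu> (Suc n) s"
        using False by (simp only: mult_left_cancel of_nat_eq_0_iff simp_thms)
      moreover have "Suc n - k = s" using Suc by (simp add: s_def)
      ultimately show ?thesis by simp
    qed
  qed
qed simp

text \<open>The case of one root. For \<open>n = 0\<close> both sides are 0: no tree is empty, and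
  the right side is a division by 0.\<close>

corollary size_prob_eq: "size_prob \<mu> n = conv_pow \<mu> n (n - 1) / real n"
proof (cases "n = 0")
  case True
  have "{t. tsize t = n} = {}" using tsize_pos True by (metis (mono_tags) Collect_empty_eq less_not_refl)
  then have "size_prob \<mu> n = 0" unfolding size_prob_def by (simp only: sum.empty)
  then show ?thesis using True by simp
next
  case False
  have "forests 1 n = (\<lambda>t. [t]) ` {t. tsize t = n}"
    by (auto simp: forests_def length_Suc_conv)
  then have "forest_weight \<mu> 1 n = size_prob \<mu> n"
    by (simp add: forest_weight_def size_prob_def sum.reindex inj_on_def)
  then show ?thesis using otter_dwass[of n 1 \<mu>] False by (simp add: field_simps)
qed

subsection \<open>Exponential moments\<close>

lemma exp_le_quadratic:
  fixes u :: real
  assumes "u \<le> 1"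
  shows "exp u \<le> 1 + u + u\<^sup>2"
proof (cases "0 \<le> u")
  case True
  then show ?thesis using exp_bound assms by blast
next
  case False
  define x where "x = - u"
  have x: "x > 0" using False by (simp add: x_def)
  have "exp u = 1 / exp x" by (simp add: x_def exp_minus field_simps)
  also have "\<dots> \<le> 1 / (1 + x)"
    using x by (intro divide_left_mono exp_ge_add_one_self) auto
  also have "\<dots> \<le> 1 - x + x\<^sup>2"
  proof -
    \<comment> \<open>The product equals 1 + x^3.\<close>
    have "1 \<le> (1 - x + x\<^sup>2) * (1 + x)"
      using x by (simp add: algebra_simps power2_eq_square)
    then show ?thesis using x by (simp add: divide_le_eq)
  qed
  finally show ?thesis by (simp add: x_def)
qed

text \<open>To first order in \<theta> the moment is 1 + \<theta> m, and the error is at most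
  \<theta>^2 D^2 because \<open>f\<close> is bounded; as m < 0, a small \<theta> brings it below
  1.\<close>

lemma exp_moment_less_1:
  fixes \<mu> f :: "nat \<Rightarrow> real"
  assumes nn: "\<And>k. 0 \<le> \<mu> k" and s1: "\<mu> sums 1" and B: "\<And>k. \<bar>f k\<bar> \<le> B"
    and m: "(\<lambda>k. \<mu> k * f k) sums m" "m < 0"
  shows "\<exists>\<theta>>0. \<exists>\<rho>. 0 \<le> \<rho> \<and> \<rho> < 1 \<and> (\<lambda>k. \<mu> k * exp (\<theta> * f k)) sums \<rho>"
proof -
  define D where "D = B + 1"
  have D: "D \<ge> 1" using B[of 0] by (simp add: D_def)
  \<comment> \<open>The first entry keeps \<open>\<theta> * f k\<close> at most 1, where the
    quadratic bound on exp holds; the second lets the linear term win.\<close>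
  define \<theta> where "\<theta> = min (1 / D) (- m / (2 * D\<^sup>2))"
  have \<theta>: "\<theta> > 0" "\<theta> * D \<le> 1" "\<theta> * D\<^sup>2 < - m"
  proof -
    show "\<theta> > 0" using D m by (auto simp: \<theta>_def intro!: divide_neg_pos)
    have "\<theta> \<le> 1 / D" by (simp add: \<theta>_def)
    then show "\<theta> * D \<le> 1" using D by (simp add: field_simps)
    have "\<theta> \<le> - m / (2 * D\<^sup>2)" by (simp add: \<theta>_def)
    then have "\<theta> * D\<^sup>2 \<le> - m / 2" using D by (simp add: field_simps)
    then show "\<theta> * D\<^sup>2 < - m" using m by linarith
  qed
  let ?g = "\<lambda>k. \<mu> k * exp (\<theta> * f k)"
  let ?h = "\<lambda>k. \<mu> k * (1 + \<theta>\<^sup>2 * D\<^sup>2) + \<theta> * (\<mu> k * f k)"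
  have h: "?h sums (1 * (1 + \<theta>\<^sup>2 * D\<^sup>2) + \<theta> * m)"
    by (intro sums_add sums_mult sums_mult2 s1 m)
  have le: "?g k \<le> ?h k" for k
  proof -
    have fD: "\<bar>f k\<bar> \<le> D" using B[of k] by (simp add: D_def)
    have "\<bar>\<theta> * f k\<bar> \<le> \<theta> * D"
      using fD \<theta> by (simp add: abs_mult mult_left_mono)
    then have a: "\<theta> * f k \<le> 1" "(\<theta> * f k)\<^sup>2 \<le> (\<theta> * D)\<^sup>2"
      using \<theta> by (linarith, intro abs_le_square_iff[THEN iffD1]) linarith
    have "exp (\<theta> * f k) \<le> 1 + \<theta> * f k + (\<theta> * D)\<^sup>2"
      using exp_le_quadratic[OF a(1)] a(2) by linarith
    then have "?g k \<le> \<mu> k * (1 + \<theta> * f k + (\<theta> * D)\<^sup>2)" using nn mult_left_mono by blast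
    then show ?thesis by (simp add: algebra_simps power_mult_distrib)
  qed
  have sg: "summable ?g"
    by (rule summable_comparison_test'[of ?h 0]) (use h le nn in \<open>auto simp: sums_iff\<close>)
  have "suminf ?g \<le> 1 * (1 + \<theta>\<^sup>2 * D\<^sup>2) + \<theta> * m"
    using suminf_le[OF le sg] h by (simp add: sums_iff)
  also have "\<dots> = 1 + \<theta> * (\<theta> * D\<^sup>2 + m)" by (simp add: algebra_simps power2_eq_square)
  also have "\<dots> < 1" using \<theta> by (simp add: mult_pos_neg)
  finally have "suminf ?g < 1" .
  moreover have "0 \<le> suminf ?g" using sg nn by (intro suminf_nonneg) auto
  ultimately show ?thesis using \<theta>(1) summable_sums[OF sg] by blast
qed

section \<open>Tails of the sum of n offspring counts\<close>

locale critical_offspring =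
  fixes \<mu> :: "nat \<Rightarrow> real"
  assumes nonneg: "0 \<le> \<mu> k" and sums_1: "\<mu> sums 1" and mean_1: "(\<lambda>k. real k * \<mu> k) sums 1"
begin

text \<open>Since the walk steps \<open>k - 1\<close> are bounded below, large deviations downwards are
  exponentially unlikely without any moment assumption beyond the mean; truncating \<open>k\<close> at
  \<open>K\<close> makes the tilted weights bounded.\<close>

lemma lower_tail_weight:
  assumes "0 < \<delta>" "\<delta> < 1"
  obtains y :: "nat \<Rightarrow> real" and l B \<rho> where "0 < l" "\<And>k. 0 \<le> y k" "\<And>k. y k \<le> B"
    "\<And>k. exp (l * (1 - \<delta> - real k)) \<le> y k" "0 \<le> \<rho>" "\<rho> < 1" "(\<lambda>k. \<mu> k * y k) sums \<rho>"
proof -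
  have "(\<lambda>n. \<Sum>k<n. real k * \<mu> k) \<longlonglongrightarrow> 1" using mean_1 by (simp add: sums_def)
  then have "\<forall>\<^sub>F n in sequentially. 1 - \<delta> < (\<Sum>k<n. real k * \<mu> k)"
    using assms by (intro order_tendstoD) auto
  \<comment> \<open>The values below \<open>K\<close> alone already contribute more than
    \<open>1 - \<delta>\<close> to the mean, so the truncated function \<open>?f\<close> has
    negative mean.\<close>
  then obtain K where K: "1 - \<delta> < (\<Sum>k<K. real k * \<mu> k)"
    by (auto simp: eventually_sequentially)
  let ?f = "\<lambda>k. 1 - \<delta> - real (min k K)"
  have S: "summable (\<lambda>k. real (min k K) * \<mu> k)"
    by (rule summable_comparison_test'[of "\<lambda>k. real k * \<mu> k" 0])
      (use mean_1 nonneg in \<open>auto simp: sums_iff intro!: mult_right_mono\<close>)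
  have "(\<Sum>k<K. real k * \<mu> k) = (\<Sum>k<K. real (min k K) * \<mu> k)"
    by (intro sum.cong) auto
  also have "\<dots> \<le> (\<Sum>k. real (min k K) * \<mu> k)"
    using S nonneg by (intro sum_le_suminf) auto
  finally have m: "(1 - \<delta>) - (\<Sum>k. real (min k K) * \<mu> k) < 0" using K by linarith
  have "(\<lambda>k. (1 - \<delta>) * \<mu> k - real (min k K) * \<mu> k) sums ((1 - \<delta>) * 1 - (\<Sum>k. real (min k K) * \<mu> k))"
    by (intro sums_diff sums_mult sums_1 summable_sums S)
  then have sm: "(\<lambda>k. \<mu> k * ?f k) sums ((1 - \<delta>) - (\<Sum>k. real (min k K) * \<mu> k))"
    by (simp add: algebra_simps)
  have bd: "\<bar>?f k\<bar> \<le> 1 + real K" for k using assms by (auto simp: min_def)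
  obtain l \<rho> where l: "l > 0" "0 \<le> \<rho>" "\<rho> < 1" "(\<lambda>k. \<mu> k * exp (l * ?f k)) sums \<rho>"
    using exp_moment_less_1[OF nonneg sums_1 bd sm m] by blast
  show thesis
  proof (rule that[of l "\<lambda>k. exp (l * ?f k)" "exp (l * 1)" \<rho>])
    show "exp (l * ?f k) \<le> exp (l * 1)" for k
      using l assms by (subst exp_le_cancel_iff, intro mult_left_mono) auto
    show "exp (l * (1 - \<delta> - real k)) \<le> exp (l * ?f k)" for k
      using l by (subst exp_le_cancel_iff, intro mult_left_mono) auto
  qed (use l in auto)
qed

text \<open>Chernoff bound: below the threshold the tilted weights \<open>\<mu> k * y k\<close>
  dominate after convolution, and their \<open>n\<close>-th convolution power has total mass
  \<open>\<rho> ^ n\<close>.\<close>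

lemma lower_tail:
  assumes "0 < \<delta>" "\<delta> < 1"
  obtains \<rho> where "0 \<le> \<rho>" "\<rho> < 1"
    "\<And>n. (\<Sum>s\<in>{s. real s < (1 - \<delta>) * real n}. conv_pow \<mu> n s) \<le> \<rho> ^ n"
proof -
  obtain y :: "nat \<Rightarrow> real" and l \<rho> where y: "0 < l" "\<And>k. 0 \<le> y k"
    "\<And>k. exp (l * (1 - \<delta> - real k)) \<le> y k" "0 \<le> \<rho>" "\<rho> < 1" "(\<lambda>k. \<mu> k * y k) sums \<rho>"
    by (rule lower_tail_weight[OF assms]) (rule that; assumption)
  let ?f = "\<lambda>k. \<mu> k * y k"
  have f0: "0 \<le> ?f k" for k using nonneg y by simp
  have le: "conv_pow \<mu> n s \<le> conv_pow ?f n s" if "real s < (1 - \<delta>) * real n" for n s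
  proof -
    let ?E = "exp (l * (1 - \<delta>))"
    have "1 \<le> exp (l * ((1 - \<delta>) * real n - real s))" using that y by simp
    also have "\<dots> = ?E ^ n * exp (- l * real s)"
      by (simp add: exp_of_nat_mult[symmetric] exp_add[symmetric] algebra_simps)
    finally have "1 * conv_pow \<mu> n s \<le> (?E ^ n * exp (- l * real s)) * conv_pow \<mu> n s"
      by (intro mult_right_mono conv_pow_nonneg nonneg)
    also have "\<dots> = conv_pow (\<lambda>k. ?E * (\<mu> k * exp (- l * real k))) n s"
      unfolding conv_pow_scale conv_pow_tilt by simp
    also have "\<dots> \<le> conv_pow ?f n s"
    proof (rule conv_pow_mono)
      fix k
      show "0 \<le> ?E * (\<mu> k * exp (- l * real k))" using nonneg by simp
      have "?E * (\<mu> k * exp (- l * real k)) = \<mu> k * exp (l * (1 - \<delta> - real k))"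
        by (simp add: exp_add[symmetric] algebra_simps)
      also have "\<dots> \<le> \<mu> k * y k" using nonneg y by (intro mult_left_mono)
      finally show "?E * (\<mu> k * exp (- l * real k)) \<le> \<mu> k * y k" .
    qed
    finally show ?thesis by simp
  qed
  have "(\<Sum>s\<in>{s. real s < (1 - \<delta>) * real n}. conv_pow \<mu> n s) \<le> \<rho> ^ n" for n
  proof -
    have S: "conv_pow ?f n sums (\<rho> ^ n)" using conv_pow_sums[OF f0 y(6)] .
    have fin: "finite {s::nat. real s < (1 - \<delta>) * real n}"
      by (rule finite_subset[of _ "{..nat \<lceil>(1 - \<delta>) * real n\<rceil>}"]) (auto, linarith)
    have "(\<Sum>s\<in>{s. real s < (1 - \<delta>) * real n}. conv_pow \<mu> n s)
        \<le> (\<Sum>s\<in>{s. real s < (1 - \<delta>) * real n}. conv_pow ?f n s)"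
      by (intro sum_mono) (use le in auto)
    also have "\<dots> \<le> suminf (conv_pow ?f n)"
      using S fin by (intro sum_le_suminf) (auto simp: sums_iff conv_pow_nonneg f0)
    finally show ?thesis using S by (simp add: sums_iff)
  qed
  then show thesis using that y by blast
qed

text \<open>Markov's inequality for the sum, whose mean is \<open>n\<close>. With no moment beyond
  the mean at hand, the upper tail is controlled only up to a constant.\<close>

lemma upper_tail_markov:
  assumes "0 < \<eta>" "0 < n"
  shows "\<eta> / (1 + \<eta>) \<le> (\<Sum>s\<in>{s. real s < (1 + \<eta>) * real n}. conv_pow \<mu> n s)"
proof -
  let ?A = "{s::nat. real s < (1 + \<eta>) * real n}"
  let ?c = "conv_pow \<mu> n"
  have fin: "finite ?A"
    by (rule finite_subset[of _ "{..nat \<lceil>(1 + \<eta>) * real n\<rceil>}"]) (auto, linarith)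
  have "(\<lambda>s. ?c s - (if s \<in> ?A then ?c s else 0)) sums (1 - sum ?c ?A)"
    using conv_pow_sums[OF nonneg sums_1, of n] by (intro sums_diff sums_If_finite_set fin) simp
  then have "(\<lambda>s. ((1 + \<eta>) * real n) * (?c s - (if s \<in> ?A then ?c s else 0)))
      sums (((1 + \<eta>) * real n) * (1 - sum ?c ?A))"
    by (rule sums_mult)
  moreover have "(\<lambda>s. real s * ?c s) sums (real n * 1)"
    by (rule conv_pow_mean_sums[OF nonneg sums_1 mean_1])
  ultimately have "((1 + \<eta>) * real n) * (1 - sum ?c ?A) \<le> real n * 1"
    by (rule sums_le[rotated 1]) (auto intro!: mult_right_mono mult_nonneg_nonneg conv_pow_nonneg nonneg)
  then have "real n * ((1 + \<eta>) * (1 - sum ?c ?A)) \<le> real n * 1"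
    by (simp only: mult.commute mult.left_commute)
  then have *: "(1 + \<eta>) * (1 - sum ?c ?A) \<le> 1"
    using assms(2) by (simp only: mult_le_cancel_left_pos of_nat_0_less_iff)
  have "\<eta> \<le> sum ?c ?A * (1 + \<eta>)" using * by (simp only: right_diff_distrib mult.commute) simp
  then show ?thesis using assms(1) by (simp add: divide_le_eq)
qed

section \<open>Subexponential lower bound for the probability of the sum n - 1\<close>

lemma offspring_le_1: "\<mu> k \<le> 1"
  using sum_le_suminf[of \<mu> "{k}"] sums_1 nonneg by (simp add: sums_iff)

text \<open>Otherwise \<open>\<mu>\<close> lives on 0 and 1, and the mean is 1 -
  \<open>\<mu> 0\<close>, which is less than 1.\<close>

lemma ex_branching:
  assumes "0 < \<mu> 0"
  obtains a where "2 \<le> a" "0 < \<mu> a"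
proof (rule ccontr)
  assume "\<not> thesis"
  then have z: "\<mu> k = 0" if "2 \<le> k" for k
    using that nonneg[of k] \<open>\<And>a. 2 \<le> a \<Longrightarrow> 0 < \<mu> a \<Longrightarrow> thesis\<close> by fastforce
  have "(\<lambda>k. real k * \<mu> k) sums (\<Sum>k<2. real k * \<mu> k)"
    by (rule sums_finite) (auto simp: z)
  moreover have "\<mu> sums (\<Sum>k<2. \<mu> k)"
    by (rule sums_finite) (auto simp: z)
  ultimately have "(\<Sum>k<2. real k * \<mu> k) = 1" "(\<Sum>k<2. \<mu> k) = 1"
    using mean_1 sums_1 sums_unique2 by blast+
  then show False using assms by (simp add: numeral_2_eq_2)
qed

text \<open>Appending a 0 raises the length by one and keeps the sum. A block of one
  \<open>a\<close> and \<open>a - 2\<close> zeros has length a - 1 and sum a, so it raises the sum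
  by one more than the length. At most \<open>d\<close> such corrections, each of weight at least
  \<gamma>, make sum and length equal.\<close>

lemma steer_to_diagonal:
  assumes "0 < \<mu> 0"
  obtains \<gamma> where "0 < \<gamma>" "\<gamma> \<le> 1"
    "\<And>n s d. s \<le> n + d \<Longrightarrow> n \<le> s + d \<Longrightarrow> \<exists>N\<ge>n. conv_pow \<mu> n s * \<gamma> ^ d \<le> conv_pow \<mu> N N"
proof -
  obtain a where a: "2 \<le> a" "0 < \<mu> a" using ex_branching[OF assms] .
  \<comment> \<open>A common lower bound for the weight \<open>\<mu> 0\<close> of a zero and the
    weight \<open>\<mu> a * \<mu> 0 ^ (a - 2)\<close> of a block, since it is their product.\<close>
  define \<gamma> where "\<gamma> = \<mu> a * \<mu> 0 ^ (a - 1)"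
  have \<gamma>: "0 < \<gamma>" "\<gamma> \<le> 1" "\<gamma> \<le> \<mu> 0" "\<gamma> \<le> \<mu> a * \<mu> 0 ^ (a - 2)"
  proof -
    show "0 < \<gamma>" using a assms by (simp add: \<gamma>_def)
    have p: "\<mu> 0 ^ (a - 1) = \<mu> 0 * \<mu> 0 ^ (a - 2)"
      using a by (simp flip: power_Suc add: numeral_2_eq_2 Suc_diff_Suc)
    have q: "0 \<le> \<mu> 0 ^ (a - 2)" "\<mu> 0 ^ (a - 2) \<le> 1"
      using nonneg offspring_le_1 by (auto simp: power_le_one)
    have "\<mu> a * \<mu> 0 ^ (a - 2) \<le> 1 * 1"
      using q nonneg offspring_le_1 by (intro mult_mono) auto
    then have "\<mu> 0 * (\<mu> a * \<mu> 0 ^ (a - 2)) \<le> \<mu> 0 * 1"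
      using nonneg by (intro mult_left_mono) auto
    then show "\<gamma> \<le> \<mu> 0" unfolding \<gamma>_def p by (simp add: mult.left_commute)
    then show "\<gamma> \<le> 1" using offspring_le_1[of 0] by linarith
    have "\<mu> 0 * (\<mu> a * \<mu> 0 ^ (a - 2)) \<le> 1 * (\<mu> a * \<mu> 0 ^ (a - 2))"
      using nonneg offspring_le_1 q by (intro mult_right_mono) auto
    then show "\<gamma> \<le> \<mu> a * \<mu> 0 ^ (a - 2)" unfolding \<gamma>_def p by (simp add: mult.left_commute)
  qed
  have "\<exists>N\<ge>n. conv_pow \<mu> n s * \<gamma> ^ d \<le> conv_pow \<mu> N N" if "s \<le> n + d" "n \<le> s + d" for n s d
  proof (cases "n \<le> s")
    case True
    have "\<gamma> ^ d \<le> \<gamma> ^ (s - n)" using that \<gamma> by (intro power_decreasing) auto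
    also have "\<dots> \<le> \<mu> 0 ^ (s - n)" using \<gamma> by (intro power_mono) auto
    also have "\<dots> \<le> conv_pow \<mu> (s - n) 0" using conv_pow_replicate_le[of \<mu> 0 "s - n"] nonneg by simp
    finally have "conv_pow \<mu> n s * \<gamma> ^ d \<le> conv_pow \<mu> n s * conv_pow \<mu> (s - n) 0"
      by (intro mult_left_mono conv_pow_nonneg nonneg)
    also have "\<dots> \<le> conv_pow \<mu> s s"
      using conv_pow_supermult[of \<mu> n s "s - n" 0] nonneg True by simp
    finally show ?thesis using True by blast
  next
    case False
    define e where "e = n - s"
    have e: "e \<le> d" "n = s + e" using that False by (auto simp: e_def)
    have "\<gamma> ^ d \<le> \<gamma> ^ e" using e \<gamma> by (intro power_decreasing) auto
    also have "\<dots> \<le> (\<mu> a * \<mu> 0 ^ (a - 2)) ^ e" using \<gamma> by (intro power_mono) auto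
    also have "\<dots> = \<mu> a ^ e * \<mu> 0 ^ ((a - 2) * e)" by (simp add: power_mult_distrib power_mult)
    also have "\<dots> \<le> conv_pow \<mu> e (a * e) * conv_pow \<mu> ((a - 2) * e) (0 * ((a - 2) * e))"
      by (intro mult_mono conv_pow_replicate_le conv_pow_nonneg zero_le_power nonneg)
    also have "\<dots> \<le> conv_pow \<mu> (e + (a - 2) * e) (a * e)"
      using conv_pow_supermult[of \<mu> e "a * e" "(a - 2) * e" 0] nonneg by simp
    finally have "conv_pow \<mu> n s * \<gamma> ^ d \<le> conv_pow \<mu> n s * conv_pow \<mu> (e + (a - 2) * e) (a * e)"
      by (intro mult_left_mono conv_pow_nonneg nonneg)
    also have "\<dots> \<le> conv_pow \<mu> (n + (e + (a - 2) * e)) (s + a * e)"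
      using conv_pow_supermult[of \<mu> n s "e + (a - 2) * e" "a * e"] nonneg by simp
    also have "s + a * e = n + (e + (a - 2) * e)"
    proof -
      have "a = 2 + (a - 2)" using a by simp
      then have "a * e = 2 * e + (a - 2) * e" by (metis add_mult_distrib)
      then show ?thesis using e by simp
    qed
    finally show ?thesis by (intro exI[of _ "n + (e + (a - 2) * e)"]) simp
  qed
  then show thesis using that \<gamma> by blast
qed

text \<open>The two tail bounds leave mass at least \<eta>/4 on sums within \<eta> n of n. There are
  at most 2n of them, so one has mass at least \<eta>/(8n). Steering it to the diagonal costs a
  factor exponential in \<eta> n only, which is affordable for small \<eta>.\<close>

lemma ex_diagonal_large:
  assumes "0 < \<mu> 0" "0 < \<epsilon>"
  obtains N where "0 < N" "exp (- \<epsilon> * real N) \<le> conv_pow \<mu> N N"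
proof -
  obtain \<gamma> where \<gamma>: "0 < \<gamma>" "\<gamma> \<le> 1"
    "\<And>n s d. s \<le> n + d \<Longrightarrow> n \<le> s + d \<Longrightarrow> \<exists>N\<ge>n. conv_pow \<mu> n s * \<gamma> ^ d \<le> conv_pow \<mu> N N"
    by (rule steer_to_diagonal[OF assms(1)]) (rule that; assumption)
  \<comment> \<open>An upper bound for the cost \<open>- ln \<gamma>\<close> of one correction, made
    at least 1 so that it can be divided by.\<close>
  define g where "g = 1 - ln \<gamma>"
  have g: "g \<ge> 1" using \<gamma> by (simp add: g_def)
  define \<eta> where "\<eta> = min (1/2) (\<epsilon> / (2 * g))"
  have \<eta>: "0 < \<eta>" "\<eta> < 1" "\<eta> * g \<le> \<epsilon> / 2"
  proof -
    show "0 < \<eta>" "\<eta> < 1" using assms g by (auto simp: \<eta>_def)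
    have "\<eta> \<le> \<epsilon> / (2 * g)" by (simp add: \<eta>_def)
    then show "\<eta> * g \<le> \<epsilon> / 2" using g by (simp add: field_simps)
  qed
  obtain \<rho> where \<rho>: "0 \<le> \<rho>" "\<rho> < 1"
    "\<And>n. (\<Sum>s\<in>{s. real s < (1 - \<eta>) * real n}. conv_pow \<mu> n s) \<le> \<rho> ^ n"
    by (rule lower_tail[OF \<eta>(1,2)]) (rule that; assumption)
  have "(\<lambda>n. \<rho> ^ n) \<longlonglongrightarrow> 0" using \<rho> by (intro LIMSEQ_power_zero) auto
  then have "\<forall>\<^sub>F n in sequentially. \<rho> ^ n < \<eta> / 4" using \<eta> by (intro order_tendstoD) auto
  moreover have "\<forall>\<^sub>F n in sequentially. exp (- (\<epsilon> / 2) * real n) \<le> \<eta> / (8 * real n)"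
    using \<eta>(1) assms(2) by real_asymp
  moreover have "\<forall>\<^sub>F n in sequentially. 0 < (n::nat)" by (rule eventually_gt_at_top)
  ultimately have "\<forall>\<^sub>F n in sequentially. \<rho> ^ n < \<eta> / 4
      \<and> exp (- (\<epsilon> / 2) * real n) \<le> \<eta> / (8 * real n) \<and> 0 < n"
    by eventually_elim auto
  then obtain n where n: "\<rho> ^ n < \<eta> / 4" "exp (- (\<epsilon> / 2) * real n) \<le> \<eta> / (8 * real n)" "0 < n"
    unfolding eventually_sequentially by blast
  let ?c = "conv_pow \<mu> n"
  let ?U = "{s::nat. real s < (1 + \<eta>) * real n}"
  let ?L = "{s::nat. real s < (1 - \<eta>) * real n}"
  have sub: "?U - ?L \<subseteq> {..<2 * n}"
  proof
    fix s assume "s \<in> ?U - ?L"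
    then have "real s < (1 + \<eta>) * real n" by simp
    also have "\<dots> \<le> 2 * real n" using \<eta> by (intro mult_right_mono) auto
    finally show "s \<in> {..<2 * n}" by simp
  qed
  have finU: "finite ?U"
    by (rule finite_subset[of _ "{..nat \<lceil>(1 + \<eta>) * real n\<rceil>}"]) (auto, linarith)
  have LU: "?L \<subseteq> ?U"
  proof
    fix s assume "s \<in> ?L"
    then have "real s < (1 - \<eta>) * real n" by simp
    also have "\<dots> \<le> (1 + \<eta>) * real n" using \<eta> by (intro mult_right_mono) auto
    finally show "s \<in> ?U" by simp
  qed
  have "\<eta> / 2 \<le> \<eta> / (1 + \<eta>)" using \<eta> by (intro divide_left_mono) auto
  then have "\<eta> / 2 \<le> sum ?c ?U" using upper_tail_markov[OF \<eta>(1) n(3)] by linarith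
  then have low: "\<eta> / 4 \<le> sum ?c (?U - ?L)"
    using \<rho>(3)[of n] n(1) sum_diff[OF finU LU, of ?c] by linarith
  have "\<exists>s\<in>?U - ?L. \<eta> / (8 * real n) \<le> ?c s"
  proof (rule ccontr)
    assume "\<not> ?thesis"
    then have small: "?c s < \<eta> / (8 * real n)" if "s \<in> ?U - ?L" for s using that by force
    have ne: "?U - ?L \<noteq> {}"
    proof
      assume "?U - ?L = {}"
      then have "sum ?c (?U - ?L) = 0" by (simp only: sum.empty)
      then show False using low \<eta> by linarith
    qed
    have "sum ?c (?U - ?L) < (\<Sum>s\<in>?U - ?L. \<eta> / (8 * real n))"
      using finU ne small by (intro sum_strict_mono) blast+
    also have "\<dots> = real (card (?U - ?L)) * (\<eta> / (8 * real n))" by simp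
    also have "\<dots> \<le> real (card {..<2 * n}) * (\<eta> / (8 * real n))"
      using card_mono[OF _ sub] \<eta> n by (intro mult_right_mono) auto
    also have "\<dots> = \<eta> / 4" using n by (simp add: field_simps)
    finally show False using low by simp
  qed
  then obtain s where s: "real s < (1 + \<eta>) * real n" "(1 - \<eta>) * real n \<le> real s" "\<eta> / (8 * real n) \<le> ?c s"
    by force
  \<comment> \<open>As \<open>s\<close> and \<open>n\<close> are integers, a distance below
    \<open>d + 1\<close> is at most \<open>d\<close>.\<close>
  define d where "d = nat \<lfloor>\<eta> * real n\<rfloor>"
  have d: "real d \<le> \<eta> * real n" "\<eta> * real n < real d + 1"
  proof -
    have "0 \<le> \<eta> * real n" using \<eta> by simp
    then show "real d \<le> \<eta> * real n" "\<eta> * real n < real d + 1" unfolding d_def by linarith+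
  qed
  have "real s < real n + real d + 1" using s(1) d(2) by (simp add: algebra_simps)
  then have sd1: "s \<le> n + d" by linarith
  have "real n < real s + real d + 1" using s(2) d(2) by (simp add: algebra_simps)
  then have sd2: "n \<le> s + d" by linarith
  obtain N where N: "N \<ge> n" "?c s * \<gamma> ^ d \<le> conv_pow \<mu> N N" using \<gamma>(3)[OF sd1 sd2] by blast
  have "ln \<gamma> \<le> 0" using \<gamma> by simp
  then have "real d * (- ln \<gamma>) \<le> (\<eta> * real n) * (- ln \<gamma>)" using d by (intro mult_right_mono) auto
  also have "\<dots> \<le> (\<eta> * real n) * g" using \<eta> by (intro mult_left_mono) (auto simp: g_def)
  also have "\<dots> = (\<eta> * g) * real n" by simp
  also have "\<dots> \<le> \<epsilon> / 2 * real n" using \<eta> by (intro mult_right_mono) auto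
  finally have "- (\<epsilon> / 2) * real n \<le> real d * ln \<gamma>" by simp
  then have "exp (- (\<epsilon> / 2) * real n) \<le> \<gamma> ^ d"
    using \<gamma>(1) by (metis exp_le_cancel_iff exp_ln exp_of_nat_mult)
  then have "exp (- (\<epsilon> / 2) * real n) * exp (- (\<epsilon> / 2) * real n) \<le> ?c s * \<gamma> ^ d"
    using n s by (intro mult_mono) (auto intro!: conv_pow_nonneg nonneg)
  also have "exp (- (\<epsilon> / 2) * real n) * exp (- (\<epsilon> / 2) * real n) = exp (- \<epsilon> * real n)"
    by (simp flip: exp_add)
  finally have "exp (- \<epsilon> * real n) \<le> conv_pow \<mu> N N" using N by linarith
  moreover have "exp (- \<epsilon> * real N) \<le> exp (- \<epsilon> * real n)" using N assms by simp
  ultimately have "exp (- \<epsilon> * real N) \<le> conv_pow \<mu> N N" by linarith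
  moreover have "0 < N" using N n by simp
  ultimately show thesis using that by blast
qed

lemma conv_pow_diagonal_multiples:
  "conv_pow \<mu> N N ^ q * conv_pow \<mu> r r \<le> conv_pow \<mu> (q * N + r) (q * N + r)"
proof (induction q)
  case (Suc q)
  have "conv_pow \<mu> N N ^ Suc q * conv_pow \<mu> r r
      \<le> conv_pow \<mu> N N * conv_pow \<mu> (q * N + r) (q * N + r)"
    using Suc by (simp add: mult.assoc mult_left_mono conv_pow_nonneg nonneg)
  also have "\<dots> \<le> conv_pow \<mu> (N + (q * N + r)) (N + (q * N + r))"
    by (rule conv_pow_supermult) (rule nonneg)
  finally show ?case by (simp add: add.assoc)
qed simp

text \<open>Fix one good \<open>N\<close>. In each residue class modulo \<open>N\<close> take the
  least \<open>m\<close> with positive value and reach every later \<open>n\<close> of the class by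
  adding copies of \<open>N\<close>; supermultiplicativity gives a constant per class. The classes
  are finitely many, so the least constant is positive.\<close>

lemma diagonal_subexponential:
  assumes "0 < \<mu> 0" "0 < \<epsilon>"
  obtains C where "0 < C"
    "\<And>n. 0 < conv_pow \<mu> n n \<Longrightarrow> C * exp (- \<epsilon> * real n) \<le> conv_pow \<mu> n n"
proof -
  obtain N where N: "0 < N" "exp (- \<epsilon> * real N) \<le> conv_pow \<mu> N N"
    using ex_diagonal_large[OF assms] .
  have "\<exists>c>0. \<forall>n. n mod N = r \<and> 0 < conv_pow \<mu> n n \<longrightarrow> c * exp (- \<epsilon> * real n) \<le> conv_pow \<mu> n n" for r
  proof (cases "\<exists>n. n mod N = r \<and> 0 < conv_pow \<mu> n n")
    case True
    define m where "m = (LEAST n. n mod N = r \<and> 0 < conv_pow \<mu> n n)"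
    have m: "m mod N = r" "0 < conv_pow \<mu> m m" using LeastI_ex[OF True] by (auto simp: m_def)
    have "conv_pow \<mu> m m * exp (- \<epsilon> * real n) \<le> conv_pow \<mu> n n"
      if "n mod N = r" "0 < conv_pow \<mu> n n" for n
    proof -
      have "m \<le> n" unfolding m_def by (rule Least_le) (use that in simp)
      moreover have "N dvd n - m" using that m \<open>m \<le> n\<close> by (simp flip: mod_eq_dvd_iff_nat)
      then obtain q where "n - m = N * q" by (rule dvdE)
      ultimately have q: "n = q * N + m" by (simp add: mult.commute)
      have "exp (- \<epsilon> * real n) \<le> exp (- \<epsilon> * real (q * N))" using q assms by simp
      also have "\<dots> = exp (- \<epsilon> * real N) ^ q" by (simp flip: exp_of_nat_mult add: algebra_simps)
      also have "\<dots> \<le> conv_pow \<mu> N N ^ q" using N by (intro power_mono) auto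
      finally have "conv_pow \<mu> m m * exp (- \<epsilon> * real n) \<le> conv_pow \<mu> m m * conv_pow \<mu> N N ^ q"
        using m by (intro mult_left_mono) auto
      also have "\<dots> \<le> conv_pow \<mu> n n"
        using conv_pow_diagonal_multiples[of N q m] q by (simp add: mult.commute)
      finally show ?thesis .
    qed
    then show ?thesis using m by blast
  next
    case False
    then show ?thesis by (intro exI[of _ 1]) auto
  qed
  then obtain c where c: "\<And>r. c r > 0"
    "\<And>r n. n mod N = r \<Longrightarrow> 0 < conv_pow \<mu> n n \<Longrightarrow> c r * exp (- \<epsilon> * real n) \<le> conv_pow \<mu> n n"
    by metis
  define C where "C = Min (c ` {..<N})"
  have "C > 0" unfolding C_def using N c(1) by (subst Min_gr_iff) auto
  moreover have "C * exp (- \<epsilon> * real n) \<le> conv_pow \<mu> n n" if "0 < conv_pow \<mu> n n" for n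
  proof -
    have "C \<le> c (n mod N)" unfolding C_def using N by (intro Min_le) auto
    then have "C * exp (- \<epsilon> * real n) \<le> c (n mod N) * exp (- \<epsilon> * real n)" by simp
    then show ?thesis using c(2)[OF refl that] by linarith
  qed
  ultimately show thesis using that by blast
qed

text \<open>Among n + 1 naturals with sum n there is a 0, and deleting it from a list of positive
  weight leaves n entries with sum n.\<close>

lemma remove_leaf:
  assumes "0 < conv_pow \<mu> (Suc n) n"
  shows "0 < \<mu> 0" "0 < conv_pow \<mu> n n"
proof -
  obtain xs where xs: "xs \<in> natpermute n (Suc n)" "prod_list (map \<mu> xs) > 0"
    using assms unfolding conv_pow_def by (meson not_le sum_nonpos)
  have "0 \<in> set xs"
  proof (rule ccontr)
    assume "0 \<notin> set xs"
    then have "length xs \<le> sum_list xs" by (induction xs) auto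
    then show False using xs by (simp add: natpermute_iff)
  qed
  then obtain us vs where uv: "xs = us @ 0 # vs" by (meson split_list)
  have p: "0 \<le> prod_list (map \<mu> zs)" for zs using nonneg by (intro prod_list_nonneg) auto
  have eq: "prod_list (map \<mu> xs) = \<mu> 0 * prod_list (map \<mu> (us @ vs))" by (simp add: uv)
  show "0 < \<mu> 0" using xs(2) eq nonneg[of 0] by (metis less_eq_real_def less_irrefl mult_zero_left)
  have pos: "0 < prod_list (map \<mu> (us @ vs))"
    using xs(2) eq p[of "us @ vs"] by (metis less_eq_real_def less_irrefl mult_zero_right)
  have "us @ vs \<in> natpermute n n" using xs(1) uv by (simp add: natpermute_iff)
  then have "prod_list (map \<mu> (us @ vs)) \<le> conv_pow \<mu> n n"
    unfolding conv_pow_def by (intro member_le_sum) (auto simp: p natpermute_finite simp del: map_append)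
  then show "0 < conv_pow \<mu> n n" using pos by linarith
qed

text \<open>Deleting a 0 gives positivity on the diagonal at \<open>n - 1\<close>, and adding a 0
  transfers the diagonal bound back. If \<open>\<mu> 0\<close> is 0, the positivity hypothesis never
  holds.\<close>

lemma conv_pow_subexponential:
  assumes "0 < \<epsilon>"
  obtains C where "0 < C"
    "\<And>n. 0 < n \<Longrightarrow> 0 < conv_pow \<mu> n (n - 1) \<Longrightarrow> C * exp (- \<epsilon> * real n) \<le> conv_pow \<mu> n (n - 1)"
proof (cases "0 < \<mu> 0")
  case True
  obtain C where C: "0 < C"
    "\<And>n. 0 < conv_pow \<mu> n n \<Longrightarrow> C * exp (- \<epsilon> * real n) \<le> conv_pow \<mu> n n"
    by (rule diagonal_subexponential[OF True assms]) (rule that; assumption)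
  show thesis
  proof (rule that[of "\<mu> 0 * C"])
    fix n :: nat assume n: "0 < n" "0 < conv_pow \<mu> n (n - 1)"
    then obtain m where m: "n = Suc m" by (cases n) auto
    have "0 < conv_pow \<mu> m m" using remove_leaf(2)[of m] n m by simp
    then have "\<mu> 0 * (C * exp (- \<epsilon> * real m)) \<le> \<mu> 0 * conv_pow \<mu> m m"
      using C True by (intro mult_left_mono) auto
    also have "\<dots> \<le> conv_pow \<mu> n (n - 1)"
      using conv_pow_supermult[of \<mu> 1 0 m m] nonneg m by (simp add: conv_pow_1)
    finally have "\<mu> 0 * C * exp (- \<epsilon> * real m) \<le> conv_pow \<mu> n (n - 1)" by (simp add: mult.assoc)
    moreover have "\<mu> 0 * C * exp (- \<epsilon> * real n) \<le> \<mu> 0 * C * exp (- \<epsilon> * real m)"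
      using m assms C True by (intro mult_left_mono) auto
    ultimately show "\<mu> 0 * C * exp (- \<epsilon> * real n) \<le> conv_pow \<mu> n (n - 1)" by linarith
  qed (use C True in auto)
next
  case False
  show thesis
    by (rule that[of 1]) (use False remove_leaf(1) in \<open>force simp: gr0_conv_Suc\<close>)+
qed

end

subsection \<open>Exchangeability\<close>

definition swap_nth :: "nat \<Rightarrow> nat \<Rightarrow> 'a list \<Rightarrow> 'a list" where
  "swap_nth i j xs = xs[i := xs ! j, j := xs ! i]"

lemma mset_swap_nth: "i < length xs \<Longrightarrow> j < length xs \<Longrightarrow> mset (swap_nth i j xs) = mset xs"
  by (simp add: swap_nth_def mset_swap)

lemma length_swap_nth [simp]: "length (swap_nth i j xs) = length xs"
  by (simp add: swap_nth_def)

lemma nth_swap_nth: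
  assumes "i < length xs" "j < length xs"
  shows "swap_nth i j xs ! p = xs ! (if p = i then j else if p = j then i else p)"
  using assms by (simp add: swap_nth_def nth_list_update)

lemma swap_nth_swap_nth: "i < length xs \<Longrightarrow> j < length xs \<Longrightarrow> swap_nth i j (swap_nth i j xs) = xs"
  by (rule nth_equalityI) (auto simp: nth_swap_nth)

lemma sum_list_swap_nth:
  assumes "i < length xs" "j < length xs"
  shows "sum_list (map g (swap_nth i j xs)) = (sum_list (map g xs) :: 'b::comm_monoid_add)"
  by (metis assms mset_map mset_swap_nth sum_mset_sum_list)

lemma prod_list_swap_nth:
  assumes "i < length xs" "j < length xs"
  shows "prod_list (map g (swap_nth i j xs)) = (prod_list (map g xs) :: 'b::comm_monoid_mult)"
  by (metis assms mset_map mset_swap_nth prod_mset_prod_list)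

text \<open>A transposition of positions is an involution of the set of lists with given length and
  sum.\<close>

lemma sum_natpermute_swap_nth:
  assumes "i < n" "j < n"
  shows "(\<Sum>xs\<in>natpermute s n. F (swap_nth i j xs)) = (\<Sum>xs\<in>natpermute s n. F xs)"
proof (rule sum.reindex_bij_witness[of _ "swap_nth i j" "swap_nth i j"])
  have "sum_list (swap_nth i j xs) = sum_list xs" if "length xs = n" for xs :: "nat list"
    using sum_list_swap_nth[of i xs j "\<lambda>x. x"] assms that by simp
  then show "swap_nth i j xs \<in> natpermute s n" if "xs \<in> natpermute s n" for xs
    using that by (simp add: natpermute_iff)
  then show "swap_nth i j xs \<in> natpermute s n" if "xs \<in> natpermute s n" for xs
    using that .
qed (use assms in \<open>auto simp: natpermute_iff swap_nth_swap_nth\<close>)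

text \<open>By exchangeability, each factor in turn can be replaced by its average over the positions
  not yet used.\<close>

lemma sample_product_le_power:
  fixes f y :: "nat \<Rightarrow> real"
  assumes f: "\<And>k. 0 \<le> f k" and y: "\<And>k. 0 \<le> y k" and "L \<le> n"
    and I: "finite I" "I \<subseteq> {..<n}" "card I \<le> L"
  shows "real (n - L) ^ card I
      * (\<Sum>xs\<in>natpermute s n. prod_list (map f xs) * (\<Prod>p\<in>I. y (xs ! p)) * sum_list (map y xs) ^ r)
    \<le> (\<Sum>xs\<in>natpermute s n. prod_list (map f xs) * sum_list (map y xs) ^ (r + card I))"
  using I
proof (induction I arbitrary: r rule: finite_induct)
  case empty
  then show ?case by simp
next
  case (insert q I)
  let ?X = "natpermute s n"
  let ?W = "\<lambda>xs. prod_list (map f xs)"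
  let ?Y = "\<lambda>xs. sum_list (map y xs)"
  let ?P = "\<lambda>xs. \<Prod>p\<in>I. y (xs ! p)"
  define T where "T p = (\<Sum>xs\<in>?X. ?W xs * ?P xs * y (xs ! p) * ?Y xs ^ r)" for p
  have W0: "0 \<le> ?W xs" "0 \<le> ?P xs" "0 \<le> ?Y xs" for xs
    using f y by (auto intro!: prod_list_nonneg prod_nonneg sum_list_nonneg)
  have T0: "0 \<le> T p" for p
    unfolding T_def using W0 y by (intro sum_nonneg mult_nonneg_nonneg) auto
  \<comment> \<open>Swapping \<open>p\<close> and \<open>q\<close> fixes the weight,
    \<open>?Y\<close> and the product over \<open>I\<close>, as neither position lies in
    \<open>I\<close>.\<close>
  have Teq: "T p = T q" if "p \<in> {..<n} - I" for p
  proof -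
    have pq: "p < n" "q < n" "p \<notin> I" "q \<notin> I" using that insert by auto
    have "T q = (\<Sum>xs\<in>?X. ?W (swap_nth p q xs) * ?P (swap_nth p q xs) * y (swap_nth p q xs ! q) * ?Y (swap_nth p q xs) ^ r)"
      unfolding T_def using pq by (intro sum_natpermute_swap_nth[symmetric])
    also have "\<dots> = T p" unfolding T_def
    proof (intro sum.cong refl)
      fix xs assume "xs \<in> ?X"
      then have l: "p < length xs" "q < length xs" using pq by (auto simp: natpermute_iff)
      have "?P (swap_nth p q xs) = ?P xs"
        using pq by (intro prod.cong refl) (auto simp: nth_swap_nth[OF l])
      then show "?W (swap_nth p q xs) * ?P (swap_nth p q xs) * y (swap_nth p q xs ! q) * ?Y (swap_nth p q xs) ^ r
          = ?W xs * ?P xs * y (xs ! p) * ?Y xs ^ r"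
        by (simp only: prod_list_swap_nth[OF l] sum_list_swap_nth[OF l] nth_swap_nth[OF l]) simp
    qed
    finally show ?thesis by simp
  qed
  have c: "card (insert q I) = Suc (card I)" using insert by simp
  have cn: "card ({..<n} - I) = n - card I" using insert by (simp add: card_Diff_subset)
  \<comment> \<open>\<open>T q\<close> is the average of \<open>T p\<close> over the
    \<open>n - card I\<close> positions outside \<open>I\<close>, of which there are at least
    \<open>n - L\<close>.\<close>
  have "real (n - L) * T q \<le> real (n - card I) * T q"
    using insert.prems c by (intro mult_right_mono T0) auto
  also have "\<dots> = (\<Sum>p\<in>{..<n} - I. T p)"
    using Teq cn by simp
  also have "\<dots> = (\<Sum>xs\<in>?X. ?W xs * ?P xs * (\<Sum>p\<in>{..<n} - I. y (xs ! p)) * ?Y xs ^ r)"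
    unfolding T_def by (subst sum.swap) (simp add: sum_distrib_left sum_distrib_right)
  also have "\<dots> \<le> (\<Sum>xs\<in>?X. ?W xs * ?P xs * ?Y xs ^ Suc r)"
  proof (intro sum_mono)
    fix xs assume "xs \<in> ?X"
    then have len: "length xs = n" by (simp add: natpermute_iff)
    have "(\<Sum>p\<in>{..<n} - I. y (xs ! p)) \<le> (\<Sum>p<n. y (xs ! p))"
      using y by (intro sum_mono2) auto
    also have "\<dots> = ?Y xs" using len by (simp add: sum_list_sum_nth atLeast0LessThan)
    finally have "(?W xs * ?P xs * ?Y xs ^ r) * (\<Sum>p\<in>{..<n} - I. y (xs ! p)) \<le> (?W xs * ?P xs * ?Y xs ^ r) * ?Y xs"
      using W0 by (intro mult_left_mono mult_nonneg_nonneg) auto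
    then show "?W xs * ?P xs * (\<Sum>p\<in>{..<n} - I. y (xs ! p)) * ?Y xs ^ r \<le> ?W xs * ?P xs * ?Y xs ^ Suc r"
      by (simp add: algebra_simps)
  qed
  finally have step: "real (n - L) * T q \<le> (\<Sum>xs\<in>?X. ?W xs * ?P xs * ?Y xs ^ Suc r)" .
  have "real (n - L) ^ card (insert q I)
      * (\<Sum>xs\<in>?X. ?W xs * (\<Prod>p\<in>insert q I. y (xs ! p)) * ?Y xs ^ r)
      = real (n - L) ^ card I * (real (n - L) * T q)"
    unfolding T_def c using insert by (simp add: algebra_simps)
  also have "\<dots> \<le> real (n - L) ^ card I * (\<Sum>xs\<in>?X. ?W xs * ?P xs * ?Y xs ^ Suc r)"
    by (intro mult_left_mono step) auto
  also have "\<dots> \<le> (\<Sum>xs\<in>?X. ?W xs * ?Y xs ^ (Suc r + card I))"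
    by (rule insert.IH) (use insert.prems c in auto)
  finally show ?case by (simp add: c)
qed

section \<open>Union bound over deficient windows\<close>

lemma sum_UN_le_sum:
  fixes f :: "'a \<Rightarrow> real"
  assumes "finite I" "\<And>i. i \<in> I \<Longrightarrow> finite (A i)" "\<And>x. 0 \<le> f x"
  shows "sum f (\<Union>i\<in>I. A i) \<le> (\<Sum>i\<in>I. sum f (A i))"
  using assms(1,2)
proof (induction I rule: finite_induct)
  case (insert i I)
  have "sum f (A i \<union> (\<Union>i\<in>I. A i)) + sum f (A i \<inter> (\<Union>i\<in>I. A i)) = sum f (A i) + sum f (\<Union>i\<in>I. A i)"
    using insert by (intro sum.union_inter) auto
  moreover have "0 \<le> sum f (A i \<inter> (\<Union>i\<in>I. A i))" by (intro sum_nonneg assms)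
  ultimately show ?case using insert by simp
qed simp

text \<open>The length is fixed, so that a list of length n has at most n windows when
  \<open>L\<close> is positive; longer stretches are cut into blocks of length
  \<open>L\<close>.\<close>

definition deficient_window :: "real \<Rightarrow> nat \<Rightarrow> nat list \<Rightarrow> bool" where
  "deficient_window \<delta> L xs \<longleftrightarrow> (\<exists>i. i + L \<le> length xs \<and> real (\<Sum>p = i..<i+L. xs ! p) \<le> (1 - \<delta>) * real L)"

context critical_offspring
begin

text \<open>The second term accounts for sequences whose empirical average of the tilted weight is
  atypical: this is unlikely at scale \<open>n\<close> rather than only at scale \<open>L\<close>.\<close>

lemma window_bound:
  assumes "0 < \<delta>" "\<delta> < 1"
  obtains \<rho> B \<sigma> \<kappa> where "0 < \<rho>" "\<rho> < 1" "1 \<le> B" "0 \<le> \<sigma>" "\<sigma> < 1" "0 < \<kappa>" "\<kappa> \<le> 1"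
    "\<And>n L i s. real L \<le> \<kappa> * real n \<Longrightarrow> i + L \<le> n \<Longrightarrow>
      (\<Sum>xs\<in>{xs\<in>natpermute s n. real (\<Sum>p = i..<i+L. xs ! p) \<le> (1 - \<delta>) * real L}. prod_list (map \<mu> xs))
      \<le> \<rho> ^ L * conv_pow \<mu> n s + B ^ L * \<sigma> ^ n"
proof -
  obtain y :: "nat \<Rightarrow> real" and l B r where y: "0 < l" "\<And>k. 0 \<le> y k" "\<And>k. y k \<le> B"
    "\<And>k. exp (l * (1 - \<delta> - real k)) \<le> y k" "0 \<le> r" "r < 1" "(\<lambda>k. \<mu> k * y k) sums r"
    by (rule lower_tail_weight[OF assms]) (rule that; assumption)
  \<comment> \<open>Two gaps are created: between \<open>r\<close> and \<open>r'\<close>, so that an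
    empirical average above \<open>r'\<close> is exponentially unlikely, and between
    \<open>r'\<close> and \<rho>, to absorb the passage from \<open>n\<close> to
    \<open>n - L\<close> positions.\<close>
  define r' where "r' = (r + 1) / 2"
  define \<rho> where "\<rho> = (r' + 1) / 2"
  have r': "r < r'" "0 < r'" "r' < 1" using y by (auto simp: r'_def)
  have \<rho>: "r' < \<rho>" "0 < \<rho>" "\<rho> < 1" using r' by (auto simp: \<rho>_def)
  have "(\<lambda>k. \<mu> k * y k - r' * \<mu> k) sums (r - r' * 1)" by (intro sums_diff sums_mult y sums_1)
  then have m: "(\<lambda>k. \<mu> k * (y k - r')) sums (r - r')" by (simp add: algebra_simps)
  have bd: "\<bar>y k - r'\<bar> \<le> B + 1" for k
    using y(2,3)[of k] r' by (simp add: abs_if)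
  obtain \<theta> \<sigma> where \<theta>: "\<theta> > 0" "0 \<le> \<sigma>" "\<sigma> < 1" "(\<lambda>k. \<mu> k * exp (\<theta> * (y k - r'))) sums \<sigma>"
    using exp_moment_less_1[OF nonneg sums_1 bd m] r' by auto
  define B' where "B' = max 1 (2 * B)"
  \<comment> \<open>The entry 1/2 gives \<open>n \<le> 2 * (n - L)\<close>, the other
    \<open>r' * n \<le> \<rho> * (n - L)\<close>.\<close>
  define \<kappa> where "\<kappa> = min (1/2) (1 - r' / \<rho>)"
  have \<kappa>: "0 < \<kappa>" using \<rho> r' by (simp add: \<kappa>_def)
  have \<kappa>1: "\<kappa> \<le> 1" by (simp add: \<kappa>_def min.coboundedI1)
  have "(\<Sum>xs\<in>{xs\<in>natpermute s n. real (\<Sum>p = i..<i+L. xs ! p) \<le> (1 - \<delta>) * real L}. prod_list (map \<mu> xs))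
      \<le> \<rho> ^ L * conv_pow \<mu> n s + B' ^ L * \<sigma> ^ n"
    if L: "real L \<le> \<kappa> * real n" "i + L \<le> n" for n L i s
  proof (cases "n = 0")
    case True
    have "(\<Sum>xs\<in>{xs\<in>natpermute s n. real (\<Sum>p = i..<i+L. xs ! p) \<le> (1 - \<delta>) * real L}. prod_list (map \<mu> xs))
        \<le> conv_pow \<mu> n s"
      unfolding conv_pow_def by (intro sum_mono2) (auto intro!: prod_list_nonneg nonneg simp: natpermute_finite)
    then show ?thesis using True L by simp
  next
    case False
    let ?X = "natpermute s n"
    let ?W = "\<lambda>xs. prod_list (map \<mu> xs)"
    let ?Y = "\<lambda>xs. sum_list (map y xs)"
    let ?V = "\<lambda>xs. prod_list (map (\<lambda>k. \<mu> k * exp (\<theta> * (y k - r'))) xs)"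
    let ?I = "{i..<i+L}"
    let ?A = "{xs\<in>?X. real (\<Sum>p = i..<i+L. xs ! p) \<le> (1 - \<delta>) * real L}"
    let ?N = "real (n - L)"
    have W0: "0 \<le> ?W xs" "0 \<le> ?Y xs" "0 \<le> ?V xs" for xs
      using nonneg y by (auto intro!: prod_list_nonneg sum_list_nonneg)
    have Ln: "L \<le> n" using L by simp
    have sub: "?I \<subseteq> {..<n}" using L by auto
    have N: "?N = real n - real L" using Ln by simp
    have "\<kappa> * real n \<le> 1/2 * real n" unfolding \<kappa>_def by (rule mult_right_mono) (rule min.cobounded1, simp)
    then have "real L \<le> 1/2 * real n" using L by linarith
    then have N2: "real n \<le> 2 * ?N" "?N > 0" using N False by auto
    have "real L \<le> (1 - r' / \<rho>) * real n"
    proof -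
      have "\<kappa> * real n \<le> (1 - r' / \<rho>) * real n" by (intro mult_right_mono) (auto simp: \<kappa>_def)
      then show ?thesis using L by linarith
    qed
    then have N1: "r' * real n \<le> \<rho> * ?N" using \<rho> by (simp add: N field_simps)
    \<comment> \<open>Chernoff step: on the event the exponents over the window have a nonnegative
      sum, so the product of the \<open>y (xs ! p)\<close> is at least 1.\<close>
    have "sum ?W ?A \<le> (\<Sum>xs\<in>?A. ?W xs * (\<Prod>p\<in>?I. y (xs ! p)))"
    proof (intro sum_mono)
      fix xs assume "xs \<in> ?A"
      then have "0 \<le> l * ((1 - \<delta>) * real L - real (\<Sum>p\<in>?I. xs ! p))" using y by simp
      then have "1 \<le> exp (l * ((1 - \<delta>) * real L - real (\<Sum>p\<in>?I. xs ! p)))" by simp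
      also have "l * ((1 - \<delta>) * real L - real (\<Sum>p\<in>?I. xs ! p)) = (\<Sum>p\<in>?I. l * (1 - \<delta> - real (xs ! p)))"
        by (simp add: sum_distrib_left[symmetric] sum_subtractf)
      also have "exp \<dots> = (\<Prod>p\<in>?I. exp (l * (1 - \<delta> - real (xs ! p))))" by (rule exp_sum) simp
      also have "\<dots> \<le> (\<Prod>p\<in>?I. y (xs ! p))" using y by (intro prod_mono) auto
      finally show "?W xs \<le> ?W xs * (\<Prod>p\<in>?I. y (xs ! p))"
        using W0(1)[of xs] mult_left_mono by fastforce
    qed
    also have "\<dots> \<le> (\<Sum>xs\<in>?X. ?W xs * (\<Prod>p\<in>?I. y (xs ! p)))"
      using W0 y by (intro sum_mono2) (auto simp: natpermute_finite intro!: mult_nonneg_nonneg prod_nonneg)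
    finally have "?N ^ L * sum ?W ?A \<le> ?N ^ L * (\<Sum>xs\<in>?X. ?W xs * (\<Prod>p\<in>?I. y (xs ! p)))"
      by (intro mult_left_mono) auto
    also have "\<dots> \<le> (\<Sum>xs\<in>?X. ?W xs * ?Y xs ^ L)"
      using sample_product_le_power[where f = \<mu> and y = y and L = L and n = n and I = ?I and s = s and r = 0]
        nonneg y(2) Ln sub by simp
    also have "\<dots> \<le> (\<Sum>xs\<in>?X. ?N ^ L * (\<rho> ^ L * ?W xs + B' ^ L * ?V xs))"
    proof (intro sum_mono)
      fix xs assume "xs \<in> ?X"
      then have len: "length xs = n" by (simp add: natpermute_iff)
      have BV: "0 \<le> \<rho> ^ L * ?W xs" "0 \<le> B' ^ L * ?V xs"
        using W0 \<rho> by (auto simp: B'_def)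
      \<comment> \<open>A typical average gives the power directly. An atypical one is bounded
        crudely through \<open>y k \<le> B\<close>, and the tilted weight \<open>?V\<close>, which
        then exceeds \<open>?W\<close>, pays for it.\<close>
      show "?W xs * ?Y xs ^ L \<le> ?N ^ L * (\<rho> ^ L * ?W xs + B' ^ L * ?V xs)"
      proof (cases "?Y xs \<le> r' * real n")
        case True
        then have "?Y xs ^ L \<le> (\<rho> * ?N) ^ L" using N1 W0 by (intro power_mono) auto
        then have "?W xs * ?Y xs ^ L \<le> ?W xs * (\<rho> * ?N) ^ L" using W0 by (intro mult_left_mono)
        also have "\<dots> = ?N ^ L * (\<rho> ^ L * ?W xs)" by (simp add: power_mult_distrib)
        also have "\<dots> \<le> ?N ^ L * (\<rho> ^ L * ?W xs + B' ^ L * ?V xs)"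
          using BV by (intro mult_left_mono) auto
        finally show ?thesis .
      next
        case False
        have "?Y xs \<le> (\<Sum>x\<leftarrow>xs. B)" using y by (intro sum_list_mono) auto
        also have "\<dots> = real n * B" by (simp add: sum_list_triv len)
        also have "\<dots> \<le> (2 * ?N) * B" using N2 y(2,3)[of 0] by (intro mult_right_mono) auto
        also have "\<dots> = (2 * B) * ?N" by simp
        also have "\<dots> \<le> B' * ?N" using N2 by (intro mult_right_mono) (auto simp: B'_def)
        finally have Y: "?Y xs ^ L \<le> (B' * ?N) ^ L" using W0 by (intro power_mono) auto
        have V: "?V xs = ?W xs * exp (\<theta> * (?Y xs - r' * real (length xs)))"
          by (induction xs) (auto simp: algebra_simps exp_add exp_diff)
        have "1 \<le> exp (\<theta> * (?Y xs - r' * real (length xs)))" using False \<theta> len by simp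
        then have "?W xs \<le> ?V xs" unfolding V using W0(1)[of xs] mult_left_mono by fastforce
        then have "?W xs * ?Y xs ^ L \<le> ?V xs * (B' * ?N) ^ L"
          using Y W0 by (intro mult_mono) auto
        also have "\<dots> = ?N ^ L * (B' ^ L * ?V xs)" by (simp add: power_mult_distrib)
        also have "\<dots> \<le> ?N ^ L * (\<rho> ^ L * ?W xs + B' ^ L * ?V xs)"
          using BV by (intro mult_left_mono) auto
        finally show ?thesis .
      qed
    qed
    also have "\<dots> = ?N ^ L * (\<rho> ^ L * conv_pow \<mu> n s + B' ^ L * conv_pow (\<lambda>k. \<mu> k * exp (\<theta> * (y k - r'))) n s)"
      by (simp only: conv_pow_def sum_distrib_left[symmetric] sum.distrib)
    finally have "sum ?W ?A \<le> \<rho> ^ L * conv_pow \<mu> n s + B' ^ L * conv_pow (\<lambda>k. \<mu> k * exp (\<theta> * (y k - r'))) n s"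
      using N2(2) by (simp only: mult_le_cancel_left_pos zero_less_power)
    also have "\<dots> \<le> \<rho> ^ L * conv_pow \<mu> n s + B' ^ L * \<sigma> ^ n"
      using conv_pow_le_power[OF _ \<theta>(4)] nonneg by (intro add_left_mono mult_left_mono) (auto simp: B'_def)
    finally show ?thesis .
  qed
  then show thesis using that[of \<rho> B' \<sigma> \<kappa>] \<rho> \<theta> \<kappa> \<kappa>1 by (simp add: B'_def)
qed

text \<open>For \<open>L\<close> near C ln n, \<open>\<rho> ^ L\<close> is at most n^-3, while
  \<open>B ^ L\<close> is polynomial in n and is beaten by \<open>\<sigma> ^ n\<close> even after
  division by the subexponential probability of the sum n - 1. The prefactor \<open>real n\<close>
  anticipates the 1/n of \<open>size_prob_eq\<close>.\<close>

lemma deficient_window_negligible: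
  assumes "0 < \<delta>" "\<delta> < 1"
  obtains C h where "0 < C" "h \<longlonglongrightarrow> (0::real)"
    "\<forall>\<^sub>F n in sequentially. 0 < conv_pow \<mu> n (n - 1) \<longrightarrow>
      real n * (\<Sum>xs\<in>{xs\<in>natpermute (n - 1) n. deficient_window \<delta> (nat \<lceil>C * ln (real n)\<rceil>) xs}. prod_list (map \<mu> xs))
      \<le> h n * conv_pow \<mu> n (n - 1)"
proof -
  obtain \<rho> B \<sigma> \<kappa> where W: "0 < \<rho>" "\<rho> < 1" "1 \<le> B" "0 \<le> \<sigma>" "\<sigma> < 1" "0 < \<kappa>" "\<kappa> \<le> 1"
    "\<And>n L i s. real L \<le> \<kappa> * real n \<Longrightarrow> i + L \<le> n \<Longrightarrow>
      (\<Sum>xs\<in>{xs\<in>natpermute s n. real (\<Sum>p = i..<i+L. xs ! p) \<le> (1 - \<delta>) * real L}. prod_list (map \<mu> xs))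
      \<le> \<rho> ^ L * conv_pow \<mu> n s + B ^ L * \<sigma> ^ n"
    by (rule window_bound[OF assms]) (rule that; assumption)
  \<comment> \<open>Half the decay rate of \<open>\<sigma> ^ n\<close>: one factor
    \<open>exp (- \<epsilon> * real n)\<close> is traded for \<open>c / D\<close>, the other beats
    the polynomial. The maximum with 1/2 covers \<sigma> = 0.\<close>
  define \<epsilon> where "\<epsilon> = - ln (max \<sigma> (1/2)) / 2"
  have \<epsilon>: "0 < \<epsilon>" "\<sigma> \<le> exp (- 2 * \<epsilon>)"
  proof -
    have "max \<sigma> (1/2) < 1" "max \<sigma> (1/2) > 0" using W by auto
    then have "ln (max \<sigma> (1/2)) < 0" by (simp only: ln_less_zero_iff)
    then show "0 < \<epsilon>" by (simp add: \<epsilon>_def)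
    have "exp (- 2 * \<epsilon>) = max \<sigma> (1/2)" by (simp add: \<epsilon>_def)
    then show "\<sigma> \<le> exp (- 2 * \<epsilon>)" by simp
  qed
  obtain D where D: "0 < D"
    "\<And>n. 0 < n \<Longrightarrow> 0 < conv_pow \<mu> n (n - 1) \<Longrightarrow> D * exp (- \<epsilon> * real n) \<le> conv_pow \<mu> n (n - 1)"
    by (rule conv_pow_subexponential[OF \<epsilon>(1)]) (rule that; assumption)
  \<comment> \<open>The decay n^-3 survives two factors n, one for the windows and one for the
    prefactor.\<close>
  define C where "C = 3 / (- ln \<rho>)"
  have C: "0 < C" "ln \<rho> * C = - 3" using W by (auto simp: C_def)
  define b where "b = ln B * C"
  have b: "0 \<le> b" using W C by (simp add: b_def)
  define h where "h n = real n * (real n * (exp (- 3 * ln (real n))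
      + B * exp (b * ln (real n)) * exp (- \<epsilon> * real n) / D))" for n :: nat
  have h0: "h \<longlonglongrightarrow> 0"
  proof -
    have "(\<lambda>n::nat. real n * (real n * exp (- 3 * ln (real n)))) \<longlonglongrightarrow> 0" by real_asymp
    moreover have "(\<lambda>n::nat. real n * (real n * (exp (b * ln (real n)) * exp (- \<epsilon> * real n)))) \<longlonglongrightarrow> 0"
      using \<epsilon>(1) by real_asymp
    then have "(\<lambda>n::nat. (B / D) * (real n * (real n * (exp (b * ln (real n)) * exp (- \<epsilon> * real n))))) \<longlonglongrightarrow> B / D * 0"
      by (intro tendsto_intros)
    ultimately have "(\<lambda>n::nat. real n * (real n * exp (- 3 * ln (real n)))
        + (B / D) * (real n * (real n * (exp (b * ln (real n)) * exp (- \<epsilon> * real n))))) \<longlonglongrightarrow> 0 + B / D * 0"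
      by (intro tendsto_add)
    then show ?thesis unfolding h_def by (simp add: algebra_simps)
  qed
  have "\<forall>\<^sub>F n in sequentially. C * ln (real n) + 1 \<le> \<kappa> * real n"
    using W(6) by real_asymp
  moreover have "\<forall>\<^sub>F n in sequentially. 2 \<le> (n::nat)" by (rule eventually_ge_at_top)
  ultimately have "\<forall>\<^sub>F n in sequentially. 0 < conv_pow \<mu> n (n - 1) \<longrightarrow>
      real n * (\<Sum>xs\<in>{xs\<in>natpermute (n - 1) n. deficient_window \<delta> (nat \<lceil>C * ln (real n)\<rceil>) xs}. prod_list (map \<mu> xs))
      \<le> h n * conv_pow \<mu> n (n - 1)"
  proof eventually_elim
    case (elim n)
    define L where "L = nat \<lceil>C * ln (real n)\<rceil>"
    define c where "c = conv_pow \<mu> n (n - 1)"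
    let ?W = "\<lambda>xs. prod_list (map \<mu> xs)"
    let ?X = "natpermute (n - 1) n"
    let ?A = "\<lambda>i. {xs\<in>?X. real (\<Sum>p = i..<i+L. xs ! p) \<le> (1 - \<delta>) * real L}"
    have lnn: "0 < ln (real n)" using elim by simp
    have Cl: "0 < C * ln (real n)" using C lnn by simp
    then have L: "C * ln (real n) \<le> real L" "real L \<le> C * ln (real n) + 1" "0 < L"
      unfolding L_def by linarith+
    have "real L \<le> 1 * real n"
      using L(2) elim(1) W(7) mult_right_mono[of \<kappa> 1 "real n"] by linarith
    then have Ln: "L \<le> n" by simp
    have W0: "0 \<le> ?W xs" for xs using nonneg by (intro prod_list_nonneg) auto
    show ?case
    proof
      assume pos: "0 < conv_pow \<mu> n (n - 1)"
      have "{xs\<in>?X. deficient_window \<delta> L xs} \<subseteq> (\<Union>i\<in>{..n - L}. ?A i)"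
      proof
        fix xs assume xs: "xs \<in> {xs\<in>?X. deficient_window \<delta> L xs}"
        then obtain i where "i + L \<le> n" "xs \<in> ?A i"
          by (auto simp: deficient_window_def natpermute_iff)
        moreover have "i \<in> {..n - L}" using \<open>i + L \<le> n\<close> by simp
        ultimately show "xs \<in> (\<Union>i\<in>{..n - L}. ?A i)" by blast
      qed
      then have "sum ?W {xs\<in>?X. deficient_window \<delta> L xs} \<le> sum ?W (\<Union>i\<in>{..n - L}. ?A i)"
        using W0 by (intro sum_mono2) (auto simp: natpermute_finite)
      also have "\<dots> \<le> (\<Sum>i\<le>n - L. sum ?W (?A i))"
        using W0 by (intro sum_UN_le_sum) (auto simp: natpermute_finite)
      also have "\<dots> \<le> (\<Sum>i\<le>n - L. \<rho> ^ L * c + B ^ L * \<sigma> ^ n)"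
      proof (rule sum_mono)
        fix i assume "i \<in> {..n - L}"
        then show "sum ?W (?A i) \<le> \<rho> ^ L * c + B ^ L * \<sigma> ^ n"
          unfolding c_def using L elim Ln by (intro W(8)) auto
      qed
      also have "\<dots> = real (Suc (n - L)) * (\<rho> ^ L * c + B ^ L * \<sigma> ^ n)" by simp
      \<comment> \<open>There are \<open>n - L + 1\<close> windows, at most \<open>n\<close> because
        \<open>L\<close> is positive.\<close>
      also have "\<dots> \<le> real n * (\<rho> ^ L * c + B ^ L * \<sigma> ^ n)"
        using L elim W pos by (intro mult_right_mono) (auto simp: c_def)
      finally have 1: "sum ?W {xs\<in>?X. deficient_window \<delta> L xs} \<le> real n * (\<rho> ^ L * c + B ^ L * \<sigma> ^ n)" .
      show "real n * sum ?W {xs\<in>?X. deficient_window \<delta> (nat \<lceil>C * ln (real n)\<rceil>) xs} \<le> h n * conv_pow \<mu> n (n - 1)"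
      proof -
        have "\<rho> ^ L = exp (real L * ln \<rho>)" using W by (simp add: exp_of_nat_mult)
        also have "\<dots> \<le> exp ((C * ln (real n)) * ln \<rho>)"
          using L W by (simp add: mult_right_mono_neg)
        also have "(C * ln (real n)) * ln \<rho> = (ln \<rho> * C) * ln (real n)" by (simp only: mult_ac)
        finally have r: "\<rho> ^ L \<le> exp (- 3 * ln (real n))" by (simp only: C)
        have "B ^ L = exp (real L * ln B)" using W by (simp add: exp_of_nat_mult)
        also have "\<dots> \<le> exp ((C * ln (real n) + 1) * ln B)"
          using L W by (simp add: mult_right_mono)
        also have "\<dots> = B * exp (b * ln (real n))"
          using W by (simp add: b_def algebra_simps exp_add)
        finally have B: "B ^ L \<le> B * exp (b * ln (real n))" .
        have "\<sigma> ^ n \<le> exp (- 2 * \<epsilon>) ^ n" using \<epsilon> W by (intro power_mono) auto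
        also have "\<dots> = exp (- \<epsilon> * real n) * exp (- \<epsilon> * real n)"
          by (simp flip: exp_of_nat_mult exp_add add: algebra_simps)
        also have "\<dots> \<le> exp (- \<epsilon> * real n) * (c / D)"
          using D(2)[of n] D(1) pos elim by (intro mult_left_mono) (auto simp: c_def field_simps)
        finally have s: "\<sigma> ^ n \<le> exp (- \<epsilon> * real n) * (c / D)" .
        have "\<rho> ^ L * c + B ^ L * \<sigma> ^ n
            \<le> exp (- 3 * ln (real n)) * c + (B * exp (b * ln (real n))) * (exp (- \<epsilon> * real n) * (c / D))"
          using r B s pos W by (intro add_mono mult_mono) (auto simp: c_def)
        also have "\<dots> = (exp (- 3 * ln (real n)) + B * exp (b * ln (real n)) * exp (- \<epsilon> * real n) / D) * c"
          by (simp add: algebra_simps)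
        finally have "real n * (real n * (\<rho> ^ L * c + B ^ L * \<sigma> ^ n)) \<le> h n * c"
          unfolding h_def mult.assoc by (intro mult_left_mono) auto
        moreover have "real n * sum ?W {xs\<in>?X. deficient_window \<delta> L xs} \<le> real n * (real n * (\<rho> ^ L * c + B ^ L * \<sigma> ^ n))"
          using 1 by (intro mult_left_mono) auto
        ultimately show ?thesis unfolding c_def L_def by linarith
      qed
    qed
  qed
  then show thesis using that C h0 by blast
qed

end

subsection \<open>Breadth-first coding\<close>

abbreviation forest_size :: "ptree list \<Rightarrow> nat" where
  "forest_size ts \<equiv> sum_list (map tsize ts)"

definition next_gen :: "ptree list \<Rightarrow> ptree list" where
  "next_gen ts = concat (map children ts)"

lemma next_gen_simps [simp]:
  "next_gen [] = []" "next_gen (t # ts) = children t @ next_gen ts"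
  by (simp_all add: next_gen_def)

lemma tsize_children: "tsize t = Suc (forest_size (children t))"
  by (cases t) simp

lemma forest_size_next_gen: "forest_size ts = length ts + forest_size (next_gen ts)"
proof (induction ts)
  case (Cons t ts)
  then show ?case using tsize_children[of t] by simp
qed simp

text \<open>Defined on forests because the state of the exploration is a whole generation; each call
  lowers the total size by the number of roots.\<close>

function bfs :: "ptree list \<Rightarrow> nat list" where
  "bfs ts = (if ts = [] then [] else map (\<lambda>t. length (children t)) ts @ bfs (next_gen ts))"
  by auto
termination
proof (relation "measure forest_size")
  fix ts :: "ptree list" assume "ts \<noteq> []"
  then show "(next_gen ts, ts) \<in> measure forest_size"
    using forest_size_next_gen[of ts] by simp
qed simp

declare bfs.simps [simp del]

lemma bfs_Nil [simp]: "bfs [] = []"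
  by (simp add: bfs.simps)

lemma bfs_eq: "bfs ts = map (\<lambda>t. length (children t)) ts @ bfs (next_gen ts)"
  by (cases "ts = []") (auto simp: bfs.simps[of ts])

lemma length_bfs: "length (bfs ts) = forest_size ts"
proof (induction ts rule: bfs.induct)
  case (1 ts)
  then show ?case
    by (cases "ts = []") (auto simp: bfs_eq[of ts] forest_size_next_gen[of ts])
qed

lemma sum_degrees: "(\<Sum>t\<leftarrow>ts. length (children t)) = length (next_gen ts)"
  by (induction ts) auto

text \<open>Every vertex except the roots is counted exactly once as a child.\<close>

lemma sum_list_bfs: "sum_list (bfs ts) + length ts = forest_size ts"
proof (induction ts rule: bfs.induct)
  case (1 ts)
  then show ?case
    by (cases "ts = []") (auto simp: bfs_eq[of ts] forest_size_next_gen[of ts] sum_degrees)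
qed

lemma bw_children: "bw \<mu> t = \<mu> (length (children t)) * prod_list (map (bw \<mu>) (children t))"
  by (cases t) simp

lemma prod_bw_next_gen:
  "prod_list (map (bw \<mu>) ts)
    = prod_list (map (\<lambda>t. \<mu> (length (children t))) ts) * prod_list (map (bw \<mu>) (next_gen ts))"
proof (induction ts)
  case (Cons t ts)
  then show ?case using bw_children[of \<mu> t] by simp
qed simp

lemma prod_bfs: "prod_list (map \<mu> (bfs ts)) = prod_list (map (bw \<mu>) ts)"
proof (induction ts rule: bfs.induct)
  case (1 ts)
  then show ?case
    by (cases "ts = []") (auto simp: bfs_eq[of ts] prod_bw_next_gen[of \<mu> ts] o_def)
qed

lemma next_gen_inject:
  assumes "length ts = length us"
    and "map (\<lambda>t. length (children t)) ts = map (\<lambda>t. length (children t)) us"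
    and "next_gen ts = next_gen us"
  shows "ts = us"
  using assms
proof (induction ts us rule: list_induct2)
  case (Cons t ts u us)
  then have "children t = children u" "next_gen ts = next_gen us" by auto
  then show ?case using Cons by (cases t; cases u) auto
qed simp

text \<open>The known number of roots marks off the first generation in the list; its child counts
  add up to the size of the next generation, so decoding continues, and they tell how to distribute
  that generation among its parents.\<close>

lemma bfs_inject: "bfs ts = bfs us \<Longrightarrow> length ts = length us \<Longrightarrow> ts = us"
proof (induction ts arbitrary: us rule: bfs.induct)
  case (1 ts)
  show ?case
  proof (cases "ts = []")
    case False
    have d: "map (\<lambda>t. length (children t)) ts = map (\<lambda>t. length (children t)) us"
      "bfs (next_gen ts) = bfs (next_gen us)"
      using 1(2,3) bfs_eq[of ts] bfs_eq[of us] by auto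
    have "length (next_gen ts) = length (next_gen us)"
      using arg_cong[OF d(1), of sum_list] by (simp only: sum_degrees)
    then have "next_gen ts = next_gen us" using 1(1)[OF False d(2)] by simp
    then show ?thesis using next_gen_inject[OF 1(3) d(1)] by simp
  qed (use 1 in simp)
qed

section \<open>Generation sizes inside the breadth-first list\<close>

lemma length_gen: "length ((next_gen ^^ h) ts) = (\<Sum>t\<leftarrow>ts. gen_size t h)"
proof (induction h arbitrary: ts)
  case 0
  have "gen_size t 0 = 1" for t by (cases t) simp
  then show ?case by (simp add: sum_list_triv)
next
  case (Suc h)
  have g: "gen_size t (Suc h) = (\<Sum>c\<leftarrow>children t. gen_size c h)" for t by (cases t) simp
  have "length ((next_gen ^^ Suc h) ts) = (\<Sum>t\<leftarrow>next_gen ts. gen_size t h)"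
    using Suc by (simp add: funpow_swap1)
  also have "\<dots> = (\<Sum>t\<leftarrow>ts. gen_size t (Suc h))" by (induction ts) (auto simp: g)
  finally show ?case .
qed

lemma gen_size_eq_length: "gen_size t h = length ((next_gen ^^ h) [t])"
  by (simp add: length_gen)

lemma bfs_contains_generation:
  "\<exists>us vs. bfs ts = us @ map (\<lambda>t. length (children t)) ((next_gen ^^ h) ts) @ vs"
proof (induction h arbitrary: ts)
  case 0
  show ?case using bfs_eq[of ts] by (metis append_Nil funpow_0)
next
  case (Suc h)
  obtain us vs where "bfs (next_gen ts) = us @ map (\<lambda>t. length (children t)) ((next_gen ^^ h) (next_gen ts)) @ vs"
    using Suc by blast
  then have "bfs ts = (map (\<lambda>t. length (children t)) ts @ us)
      @ map (\<lambda>t. length (children t)) ((next_gen ^^ Suc h) ts) @ vs"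
    using bfs_eq[of ts] by (simp add: funpow_swap1)
  then show ?case by blast
qed

text \<open>Telescopes \<open>forest_size_next_gen\<close>: each passage to the next generation
  removes exactly the current roots.\<close>

lemma sum_generations: "(\<Sum>h<k. length ((next_gen ^^ h) ts)) + forest_size ((next_gen ^^ k) ts) = forest_size ts"
proof (induction k)
  case (Suc k)
  then show ?case using forest_size_next_gen[of "(next_gen ^^ k) ts"] by simp
qed simp

lemma sum_gen_size_le: "(\<Sum>h<k. gen_size t h) \<le> tsize t"
  using sum_generations[where ts = "[t]" and k = k] by (simp add: gen_size_eq_length)

lemma gen_size_eq_0: "height t < k \<Longrightarrow> gen_size t k = 0"
proof (induction t arbitrary: k)
  case (Node ts)
  then obtain k' where k: "k = Suc k'" by (cases k) auto
  have "gen_size s k' = 0" if "s \<in> set ts" for s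
  proof (rule Node.IH[OF that])
    have "Suc (height s) \<le> height (Node ts)"
      using that by (auto intro!: Max_ge)
    then show "height s < k'" using Node.prems k by (simp del: height.simps)
  qed
  then show ?case by (simp add: k)
qed

lemma sum_gen_size: "(\<Sum>h\<le>height t. gen_size t h) = tsize t"
proof -
  have "(next_gen ^^ Suc (height t)) [t] = []"
    using gen_size_eq_0[of t "Suc (height t)"] unfolding gen_size_eq_length by (simp del: funpow.simps)
  then show ?thesis
    using sum_generations[where ts = "[t]" and k = "Suc (height t)"]
    by (simp add: gen_size_eq_length lessThan_Suc_atMost del: funpow.simps sum.lessThan_Suc)
qed

text \<open>Cut generation \<open>h\<close> into blocks of length \<open>L\<close>, each of average
  above 1 - \<delta>/2. The remainder of fewer than \<open>L\<close> vertices is at most a share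
  \<delta>/2 of the generation by the size hypothesis, so dropping it uses up the other half of
  \<delta>.\<close>

lemma generation_shrinks_slowly:
  assumes d: "0 < \<delta>" "\<delta> < 1" and L: "0 < L" and ns: "\<not> deficient_window (\<delta> / 2) L (bfs [t])"
    and big: "2 * real L / \<delta> \<le> real (gen_size t h)"
  shows "(1 - \<delta>) * real (gen_size t h) \<le> real (gen_size t (Suc h))"
proof -
  define gs where "gs = (next_gen ^^ h) [t]"
  define ws where "ws = map (\<lambda>t. length (children t)) gs"
  define m where "m = gen_size t h"
  define q where "q = m div L"
  have lenw: "length ws = m" by (simp add: ws_def gs_def m_def gen_size_eq_length)
  have sumw: "sum_list ws = gen_size t (Suc h)"
    by (simp add: ws_def gs_def gen_size_eq_length sum_degrees)
  obtain us vs where xs: "bfs [t] = us @ ws @ vs"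
    using bfs_contains_generation[of "[t]" h] by (auto simp: ws_def gs_def)
  have qm: "q * L \<le> m" "m < q * L + L"
    using L div_mult_mod_eq[of m L] mod_less_divisor[of L m] unfolding q_def by linarith+
  have block: "(1 - \<delta> / 2) * real L \<le> real (\<Sum>p = j * L..<j * L + L. ws ! p)" if "j < q" for j
  proof -
    have "Suc j * L \<le> q * L" using that by (intro mult_right_mono) auto
    then have jm: "j * L + L \<le> m" using qm by simp
    then have "\<not> real (\<Sum>p = (length us + j * L)..<(length us + j * L) + L. bfs [t] ! p) \<le> (1 - \<delta> / 2) * real L"
      using ns lenw unfolding deficient_window_def xs by auto
    also have "(\<Sum>p = (length us + j * L)..<(length us + j * L) + L. bfs [t] ! p)
        = (\<Sum>p = j * L + length us..<(j * L + L) + length us. bfs [t] ! p)" by (simp add: ac_simps)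
    also have "\<dots> = (\<Sum>p = j * L..<j * L + L. bfs [t] ! (p + length us))"
      by (rule sum.shift_bounds_nat_ivl)
    also have "\<dots> = (\<Sum>p = j * L..<j * L + L. ws ! p)"
      using jm lenw by (intro sum.cong) (auto simp: xs nth_append)
    finally show ?thesis by linarith
  qed
  have "real q * ((1 - \<delta> / 2) * real L) = (\<Sum>j<q. (1 - \<delta> / 2) * real L)" by simp
  also have "\<dots> \<le> (\<Sum>j<q. real (\<Sum>p = j * L..<j * L + L. ws ! p))"
    by (intro sum_mono block) auto
  also have "\<dots> = real (\<Sum>p<q * L. ws ! p)"
    unfolding of_nat_sum[symmetric] by (simp only: sum.nat_group)
  also have "(\<Sum>p<q * L. ws ! p) \<le> (\<Sum>p<m. ws ! p)" using qm by (intro sum_mono2) auto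
  also have "\<dots> = gen_size t (Suc h)"
    using sumw lenw by (simp add: sum_list_sum_nth atLeast0LessThan)
  finally have 1: "(1 - \<delta> / 2) * real (q * L) \<le> real (gen_size t (Suc h))" by (simp add: algebra_simps)
  have "real m < real (q * L) + real L" using qm(2) by linarith
  then have "(1 - \<delta> / 2) * (real m - real L) \<le> (1 - \<delta> / 2) * real (q * L)"
    using d by (intro mult_left_mono) auto
  moreover have "(1 - \<delta>) * real m \<le> (1 - \<delta> / 2) * (real m - real L)"
  proof -
    have e: "(1 - \<delta> / 2) * (real m - real L) = real m - real L - \<delta> * real m / 2 + \<delta> * real L / 2"
      by (simp add: field_simps)
    have "2 * real L \<le> \<delta> * real m" "0 \<le> \<delta> * real L" using big d by (auto simp: m_def field_simps)
    moreover have e': "(1 - \<delta>) * real m = real m - \<delta> * real m" by (simp add: algebra_simps)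
    ultimately show ?thesis unfolding e e' by linarith
  qed
  ultimately show ?thesis using 1 unfolding m_def[symmetric] by (meson order_trans)
qed

subsection \<open>Slow decay of the generation sizes\<close>

text \<open>As long as the geometric lower bound stays above \<open>A\<close>, the step applies
  again. It does so up to exponent \<open>j\<close>, and one further step from there reaches
  \<open>Suc j\<close>.\<close>

lemma geometric_decay:
  fixes z :: "nat \<Rightarrow> real"
  assumes step: "\<And>h. A \<le> z h \<Longrightarrow> (1 - \<delta>) * z h \<le> z (Suc h)"
    and "0 \<le> \<delta>" "\<delta> < 1" "0 \<le> z h" and A: "A \<le> (1 - \<delta>) ^ j * z h" and "i \<le> Suc j"
  shows "(1 - \<delta>) ^ i * z h \<le> z (h + i)"
  using \<open>i \<le> Suc j\<close>
proof (induction i)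
  case (Suc i)
  then have IH: "(1 - \<delta>) ^ i * z h \<le> z (h + i)" by simp
  have "(1 - \<delta>) ^ j * z h \<le> (1 - \<delta>) ^ i * z h"
    using Suc.prems assms by (intro mult_right_mono power_decreasing) auto
  then have "(1 - \<delta>) * z (h + i) \<le> z (Suc (h + i))" using A IH by (intro step) linarith
  moreover have "(1 - \<delta>) * ((1 - \<delta>) ^ i * z h) \<le> (1 - \<delta>) * z (h + i)"
    using IH assms by (intro mult_left_mono) auto
  ultimately show ?case by (simp add: mult.assoc)
qed simp

text \<open>With \<delta> = 1/(2J), Bernoulli's inequality keeps \<open>J\<close> consecutive
  generations, from the widest one on, above \<epsilon> n/2. Since J \<epsilon> is at least 4, they
  hold at least 2n vertices in total, which is too many.\<close>

lemma wide_imp_deficient_window: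
  assumes \<epsilon>: "0 < \<epsilon>" and J: "4 \<le> real J * \<epsilon>" "0 < J" and L: "0 < L"
    and A: "2 * real L * (2 * real J) \<le> \<epsilon> * real (tsize t) / 2"
    and w: "\<epsilon> * real (tsize t) < real (width t)"
  shows "deficient_window (1 / (2 * real J) / 2) L (bfs [t])"
proof (rule ccontr)
  assume ns: "\<not> deficient_window (1 / (2 * real J) / 2) L (bfs [t])"
  define \<delta> where "\<delta> = 1 / (2 * real J)"
  define n where "n = tsize t"
  have n: "0 < n" by (simp add: n_def tsize_pos)
  have \<delta>: "0 < \<delta>" "\<delta> < 1" using J by (auto simp: \<delta>_def field_simps)
  have step: "(1 - \<delta>) * real (gen_size t h) \<le> real (gen_size t (Suc h))"
    if "2 * real L * (2 * real J) \<le> real (gen_size t h)" for h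
    using generation_shrinks_slowly[OF \<delta> L, of t h] ns that by (simp add: \<delta>_def)
  have "width t \<in> gen_size t ` {0..height t}"
    unfolding width_def by (intro Max_in) auto
  then obtain h where h: "width t = gen_size t h" by auto
  have half: "1 / 2 \<le> (1 - \<delta>) ^ i" if "i \<le> J" for i
  proof -
    have "real i * \<delta> \<le> 1 / 2" using that J by (simp add: \<delta>_def field_simps)
    moreover have "1 + real i * (- \<delta>) \<le> (1 + (- \<delta>)) ^ i"
      using \<delta> by (intro Bernoulli_inequality) auto
    ultimately show ?thesis by simp
  qed
  have zh: "\<epsilon> * real n < real (gen_size t h)" using w h by (simp add: n_def)
  have "2 * real L * (2 * real J) \<le> 1 / 2 * real (gen_size t h)" using A zh by (simp add: n_def)
  also have "\<dots> \<le> (1 - \<delta>) ^ J * real (gen_size t h)" using half[of J] by (intro mult_right_mono) auto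
  finally have A': "2 * real L * (2 * real J) \<le> (1 - \<delta>) ^ J * real (gen_size t h)" .
  have low: "\<epsilon> * real n / 2 \<le> real (gen_size t (h + i))" if "i \<le> J" for i
  proof -
    have "\<epsilon> * real n / 2 \<le> 1 / 2 * real (gen_size t h)" using zh by simp
    also have "\<dots> \<le> (1 - \<delta>) ^ i * real (gen_size t h)" using half[OF that] by (intro mult_right_mono) auto
    also have "\<dots> \<le> real (gen_size t (h + i))"
      by (rule geometric_decay[where z = "\<lambda>h. real (gen_size t h)", OF step _ _ _ A']) (use \<delta> that in auto)
    finally show ?thesis .
  qed
  have "2 * real n \<le> (real J * \<epsilon>) * real n / 2" using J n mult_right_mono[OF J(1), of "real n"] by simp
  also have "\<dots> = (\<Sum>i<J. \<epsilon> * real n / 2)" by simp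
  also have "\<dots> \<le> (\<Sum>i<J. real (gen_size t (h + i)))" by (intro sum_mono low) auto
  also have "\<dots> = real (\<Sum>k=h..<h + J. gen_size t k)"
    using sum.shift_bounds_nat_ivl[of "gen_size t" 0 h J]
    by (simp add: atLeast0LessThan ac_simps)
  also have "\<dots> \<le> real (\<Sum>k<h + J. gen_size t k)" by (intro of_nat_mono sum_mono2) auto
  also have "\<dots> \<le> real n" unfolding n_def using sum_gen_size_le of_nat_mono by blast
  finally show False using n by simp
qed

text \<open>By pigeonhole some generation holds a share 1/(H+1) of the vertices. By hypothesis it
  stays above the threshold 2L/\<delta> through \<open>H\<close> shrinkings.\<close>

lemma short_imp_deficient_window:
  assumes \<delta>: "0 < \<delta>" "\<delta> < 1" and L: "0 < L"
    and A: "2 * real L / \<delta> * real (Suc (height t)) \<le> (1 - \<delta>) ^ height t * real (tsize t)"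
  shows "deficient_window (\<delta> / 2) L (bfs [t])"
proof (rule ccontr)
  assume ns: "\<not> deficient_window (\<delta> / 2) L (bfs [t])"
  define H where "H = height t"
  have step: "(1 - \<delta>) * real (gen_size t h) \<le> real (gen_size t (Suc h))"
    if "2 * real L / \<delta> \<le> real (gen_size t h)" for h
    using generation_shrinks_slowly[OF \<delta> L ns that] .
  have "\<exists>h\<le>H. real (tsize t) \<le> real (Suc H) * real (gen_size t h)"
  proof (rule ccontr)
    assume "\<not> ?thesis"
    then have "real (Suc H) * real (gen_size t h) < real (tsize t)" if "h \<le> H" for h
      using that by force
    then have "(\<Sum>h\<le>H. real (Suc H) * real (gen_size t h)) < (\<Sum>h\<le>H. real (tsize t))"
      by (intro sum_strict_mono) auto
    also have "\<dots> = real (Suc H) * real (tsize t)" by simp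
    also have "\<dots> = (\<Sum>h\<le>H. real (Suc H) * real (gen_size t h))"
      unfolding sum_distrib_left[symmetric] of_nat_sum[symmetric] H_def sum_gen_size ..
    finally show False by simp
  qed
  then obtain h where h: "real (tsize t) \<le> real (Suc H) * real (gen_size t h)" by blast
  have "0 < real (Suc H) * real (gen_size t h)" using h tsize_pos[of t] by linarith
  then have zpos: "0 < real (gen_size t h)" by (simp add: zero_less_mult_iff)
  have "2 * real L / \<delta> * real (Suc H) \<le> (1 - \<delta>) ^ H * real (tsize t)" using A by (simp add: H_def)
  also have "\<dots> \<le> (1 - \<delta>) ^ H * (real (Suc H) * real (gen_size t h))"
    using \<delta> h by (intro mult_left_mono) auto
  also have "\<dots> = ((1 - \<delta>) ^ H * real (gen_size t h)) * real (Suc H)" by simp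
  finally have A': "2 * real L / \<delta> \<le> (1 - \<delta>) ^ H * real (gen_size t h)"
    by (rule mult_right_le_imp_le) simp
  \<comment> \<open>One step beyond \<open>H\<close> makes generation \<open>h + Suc H\<close>
    nonempty even for \<open>h = 0\<close>, although it lies past the height.\<close>
  have "(1 - \<delta>) ^ Suc H * real (gen_size t h) \<le> real (gen_size t (h + Suc H))"
    by (rule geometric_decay[where z = "\<lambda>h. real (gen_size t h)", OF step _ _ _ A']) (use \<delta> in auto)
  moreover have "gen_size t (h + Suc H) = 0" by (rule gen_size_eq_0) (simp add: H_def)
  moreover have "0 < (1 - \<delta>) ^ Suc H * real (gen_size t h)" using zpos \<delta> by simp
  ultimately show False by simp
qed

section \<open>Conditional probabilities of small height and large width\<close>

context critical_offspring
begin

text \<open>Breadth-first coding maps the trees with \<open>Q n\<close> injectively and with equal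
  weight into the lists with a deficient window, and \<open>size_prob_eq\<close> turns the quotient
  into the one already bounded by \<open>h n\<close>. The assumption covers every \<open>C\<close>
  since the actual one is supplied by \<open>deficient_window_negligible\<close>.\<close>

lemma cond_prob_tendsto_0:
  assumes \<delta>: "0 < \<delta>" "\<delta> < 1"
    and Q: "\<And>C. 0 < C \<Longrightarrow> \<forall>\<^sub>F n in sequentially. \<forall>t. tsize t = n \<longrightarrow> Q n t \<longrightarrow>
        deficient_window \<delta> (nat \<lceil>C * ln (real n)\<rceil>) (bfs [t])"
  shows "((\<lambda>n. cond_prob \<mu> n (Q n)) \<longlongrightarrow> 0) (inf sequentially (principal {n. 0 < size_prob \<mu> n}))"
proof -
  obtain C h where Ch: "0 < C" "h \<longlonglongrightarrow> (0::real)"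
    and ev: "\<forall>\<^sub>F n in sequentially. 0 < conv_pow \<mu> n (n - 1) \<longrightarrow>
      real n * (\<Sum>xs\<in>{xs\<in>natpermute (n - 1) n. deficient_window \<delta> (nat \<lceil>C * ln (real n)\<rceil>) xs}. prod_list (map \<mu> xs))
      \<le> h n * conv_pow \<mu> n (n - 1)"
    by (rule deficient_window_negligible[OF \<delta>])
  have bw0: "0 \<le> bw \<mu> t" for t
    by (induction t) (auto intro!: mult_nonneg_nonneg prod_list_nonneg nonneg)
  have "\<forall>\<^sub>F n in sequentially. 0 < size_prob \<mu> n \<longrightarrow> cond_prob \<mu> n (Q n) \<le> h n"
    using ev Q[OF Ch(1)]
  proof eventually_elim
    case (elim n)
    let ?S = "{xs\<in>natpermute (n - 1) n. deficient_window \<delta> (nat \<lceil>C * ln (real n)\<rceil>) xs}"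
    let ?T = "{t. tsize t = n \<and> Q n t}"
    show ?case
    proof
      assume pos: "0 < size_prob \<mu> n"
      define c where "c = conv_pow \<mu> n (n - 1)"
      have sp: "size_prob \<mu> n = c / real n" unfolding c_def by (rule size_prob_eq)
      have n: "0 < n" using pos sp by (cases n) auto
      have c: "0 < c" using pos n sp by (simp add: zero_less_divide_iff)
      have inj: "inj_on (\<lambda>t. bfs [t]) ?T" by (rule inj_onI) (use bfs_inject in fastforce)
      have img: "(\<lambda>t. bfs [t]) ` ?T \<subseteq> ?S"
      proof (rule image_subsetI)
        fix t assume t: "t \<in> ?T"
        then have "length (bfs [t]) = n" "sum_list (bfs [t]) + 1 = n"
          using length_bfs[of "[t]"] sum_list_bfs[of "[t]"] by auto
        then show "bfs [t] \<in> ?S" using elim(2) t by (auto simp: natpermute_iff)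
      qed
      have "(\<Sum>t\<in>?T. bw \<mu> t) = (\<Sum>t\<in>?T. prod_list (map \<mu> (bfs [t])))" by (simp add: prod_bfs)
      also have "\<dots> = (\<Sum>xs\<in>(\<lambda>t. bfs [t]) ` ?T. prod_list (map \<mu> xs))"
        by (simp add: sum.reindex[OF inj])
      also have "\<dots> \<le> (\<Sum>xs\<in>?S. prod_list (map \<mu> xs))"
        by (intro sum_mono2 img) (auto simp: natpermute_finite intro!: prod_list_nonneg nonneg)
      finally have "real n * (\<Sum>t\<in>?T. bw \<mu> t) \<le> real n * (\<Sum>xs\<in>?S. prod_list (map \<mu> xs))"
        by (intro mult_left_mono) auto
      also have "\<dots> \<le> h n * c" using elim(1) c by (simp add: c_def)
      finally have "real n * (\<Sum>t\<in>?T. bw \<mu> t) / c \<le> h n" using c by (simp add: divide_le_eq)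
      then show "cond_prob \<mu> n (Q n) \<le> h n" unfolding cond_prob_def sp using n by (simp add: mult.commute)
    qed
  qed
  then have up: "\<forall>\<^sub>F n in inf sequentially (principal {n. 0 < size_prob \<mu> n}). cond_prob \<mu> n (Q n) \<le> h n"
    by (simp add: eventually_inf_principal)
  have low: "\<forall>\<^sub>F n in inf sequentially (principal {n. 0 < size_prob \<mu> n}). 0 \<le> cond_prob \<mu> n (Q n)"
    unfolding eventually_inf_principal
    by (intro always_eventually) (auto simp: cond_prob_def intro!: divide_nonneg_nonneg sum_nonneg bw0)
  have "(h \<longlongrightarrow> 0) (inf sequentially (principal {n. 0 < size_prob \<mu> n}))"
    using Ch(2) by (rule tendsto_mono[OF inf_le1])
  then show ?thesis by (rule tendsto_sandwich[OF low up tendsto_const])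
qed

lemma height_tendsto:
  assumes "0 < M"
  shows "((\<lambda>n. cond_prob \<mu> n (\<lambda>t. real (height t) \<le> M * ln (real n))) \<longlongrightarrow> 0)
    (inf sequentially (principal {n. 0 < size_prob \<mu> n}))"
proof -
  \<comment> \<open>The bound 1/2 gives ln (1 - \<delta>) \<ge> - 2 \<delta>; with \<delta> M \<le>
    1/4 a tree of height at most M ln n then has \<open>(1 - \<delta>) ^ height t\<close> at least
    n^(-1/2).\<close>
  define \<delta> where "\<delta> = min (1/2) (1 / (4 * M))"
  have \<delta>: "0 < \<delta>" "\<delta> \<le> 1/2" "\<delta> * M \<le> 1/4"
  proof -
    show "0 < \<delta>" "\<delta> \<le> 1/2" using assms by (auto simp: \<delta>_def)
    have "\<delta> \<le> 1 / (4 * M)" by (simp add: \<delta>_def)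
    then show "\<delta> * M \<le> 1/4" using assms by (simp add: field_simps)
  qed
  show ?thesis
  proof (rule cond_prob_tendsto_0[of "\<delta> / 2"])
    fix C :: real assume C: "0 < C"
    \<comment> \<open>The left side is of order (ln n)^2, the right side is \<delta> times the
      square root of n.\<close>
    have "\<forall>\<^sub>F n in sequentially. 2 * (C * ln (real n) + 1) * (M * ln (real n) + 1)
        \<le> \<delta> * (exp (- ln (real n) / 2) * real n)"
      using C assms \<delta>(1) by real_asymp
    moreover have "\<forall>\<^sub>F n in sequentially. 2 \<le> (n::nat)" by (rule eventually_ge_at_top)
    ultimately show "\<forall>\<^sub>F n in sequentially. \<forall>t. tsize t = n \<longrightarrow> real (height t) \<le> M * ln (real n) \<longrightarrow>
        deficient_window (\<delta> / 2) (nat \<lceil>C * ln (real n)\<rceil>) (bfs [t])"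
    proof (eventually_elim, intro allI impI)
      fix n t
      assume n: "2 * (C * ln (real n) + 1) * (M * ln (real n) + 1) \<le> \<delta> * (exp (- ln (real n) / 2) * real n)"
        "2 \<le> n" and t: "tsize t = n" "real (height t) \<le> M * ln (real n)"
      define L where "L = nat \<lceil>C * ln (real n)\<rceil>"
      have lnn: "0 < ln (real n)" using n by simp
      have "0 < C * ln (real n)" using C lnn by simp
      then have L: "real L \<le> C * ln (real n) + 1" "0 < L" unfolding L_def by linarith+
      have "deficient_window (\<delta> / 2) L (bfs [t])"
      proof (rule short_imp_deficient_window)
        have "2 * real L * real (Suc (height t)) \<le> 2 * (C * ln (real n) + 1) * (M * ln (real n) + 1)"
          using L t C lnn by (intro mult_mono) auto
        also note n(1)
        also have "\<delta> * (exp (- ln (real n) / 2) * real n) \<le> \<delta> * ((1 - \<delta>) ^ height t * real n)"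
        proof -
          have "- 2 * \<delta> \<le> - \<delta> - 2 * \<delta>\<^sup>2" using \<delta> by (simp add: power2_eq_square)
          also have "\<dots> \<le> ln (1 - \<delta>)" using \<delta> by (intro ln_one_minus_pos_lower_bound) auto
          finally have l: "- 2 * \<delta> \<le> ln (1 - \<delta>)" .
          have "real (height t) * (2 * \<delta>) \<le> (M * ln (real n)) * (2 * \<delta>)"
            using t \<delta> by (intro mult_right_mono) auto
          also have "\<dots> = (\<delta> * M) * (2 * ln (real n))" by simp
          also have "\<dots> \<le> 1/4 * (2 * ln (real n))" using \<delta> lnn by (intro mult_right_mono) auto
          finally have "- ln (real n) / 2 \<le> real (height t) * (- 2 * \<delta>)" by simp
          also have "\<dots> \<le> real (height t) * ln (1 - \<delta>)" using l by (intro mult_left_mono) auto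
          finally have "exp (- ln (real n) / 2) \<le> exp (real (height t) * ln (1 - \<delta>))" by simp
          also have "\<dots> = (1 - \<delta>) ^ height t" using \<delta> by (simp add: exp_of_nat_mult)
          finally show ?thesis using \<delta> by (intro mult_left_mono mult_right_mono) auto
        qed
        finally have "2 * real L * real (Suc (height t)) \<le> \<delta> * ((1 - \<delta>) ^ height t * real n)" .
        then show "2 * real L / \<delta> * real (Suc (height t)) \<le> (1 - \<delta>) ^ height t * real (tsize t)"
          using \<delta> t by (simp add: field_simps)
      qed (use \<delta> L in auto)
      then show "deficient_window (\<delta> / 2) (nat \<lceil>C * ln (real n)\<rceil>) (bfs [t])" by (simp add: L_def)
    qed
  qed (use \<delta> in auto)
qed

lemma width_tendsto:
  assumes "0 < \<epsilon>"
  shows "((\<lambda>n. cond_prob \<mu> n (\<lambda>t. \<epsilon> * real n < real (width t))) \<longlongrightarrow> 0)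
    (inf sequentially (principal {n. 0 < size_prob \<mu> n}))"
proof -
  \<comment> \<open>\<open>J\<close> generations of size \<epsilon> n/2 are to exceed the whole
    tree.\<close>
  obtain J :: nat where "4 / \<epsilon> < real J" using reals_Archimedean2 by blast
  then have J: "4 \<le> real J * \<epsilon>" using assms by (simp add: field_simps)
  have J0: "0 < J" using J by (cases J) auto
  show ?thesis
  proof (rule cond_prob_tendsto_0[of "1 / (2 * real J) / 2"])
    fix C :: real assume C: "0 < C"
    have "\<forall>\<^sub>F n in sequentially. 2 * (C * ln (real n) + 1) * (2 * real J) \<le> \<epsilon> * real n / 2"
      using C assms by real_asymp
    moreover have "\<forall>\<^sub>F n in sequentially. 2 \<le> (n::nat)" by (rule eventually_ge_at_top)
    ultimately show "\<forall>\<^sub>F n in sequentially. \<forall>t. tsize t = n \<longrightarrow> \<epsilon> * real n < real (width t) \<longrightarrow>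
        deficient_window (1 / (2 * real J) / 2) (nat \<lceil>C * ln (real n)\<rceil>) (bfs [t])"
    proof (eventually_elim, intro allI impI)
      fix n t
      assume n: "2 * (C * ln (real n) + 1) * (2 * real J) \<le> \<epsilon> * real n / 2" "2 \<le> n"
        and t: "tsize t = n" "\<epsilon> * real n < real (width t)"
      define L where "L = nat \<lceil>C * ln (real n)\<rceil>"
      have "0 < C * ln (real n)" using C n by simp
      then have L: "real L \<le> C * ln (real n) + 1" "0 < L" unfolding L_def by linarith+
      have "2 * real L * (2 * real J) \<le> 2 * (C * ln (real n) + 1) * (2 * real J)"
        using L by (intro mult_right_mono mult_left_mono) auto
      then have "2 * real L * (2 * real J) \<le> \<epsilon> * real (tsize t) / 2"
        unfolding t(1) by (rule order_trans) (rule n(1))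
      then show "deficient_window (1 / (2 * real J) / 2) (nat \<lceil>C * ln (real n)\<rceil>) (bfs [t])"
        using wide_imp_deficient_window[OF assms J J0 L(2)] t by (simp add: L_def)
    qed
  qed (use J0 in \<open>auto simp: field_simps\<close>)
qed

end

theorem theorem1:
  fixes \<mu> :: "nat \<Rightarrow> real"
  assumes "offspring_distribution \<mu>" and "critical \<mu>"
  shows "(\<forall>M>0. ((\<lambda>n. cond_prob \<mu> n (\<lambda>t. real (height t) \<le> M * ln (real n)))
              \<longlongrightarrow> 0) (inf sequentially (principal {n. 0 < size_prob \<mu> n})))
       \<and> (\<forall>\<epsilon>>0. ((\<lambda>n. cond_prob \<mu> n (\<lambda>t. real (width t) > \<epsilon> * real n))
              \<longlongrightarrow> 0) (inf sequentially (principal {n. 0 < size_prob \<mu> n})))"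
proof -
  interpret critical_offspring \<mu>
    using assms by unfold_locales (auto simp: offspring_distribution_def critical_def)
  show ?thesis using height_tendsto width_tendsto by blast
qed

end
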